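(* Let $G$ be a closed group of Weyl-transitive, type-preserving automorphisms of a thick, locally finite building $(\Delta,\delta)$ and let $g\in G$. Then the stabilizer of a simplex $a$ is tidy for $g$ if and only if $\delta(a,g.a)$ is $\operatorname{cotype}(a)$-straight.
   Context: $\Delta$ is a building of type $(W,S)$, $S$ finite, $\ell$ the length function; for $J\subseteq S$, $W_J=\langle J\rangle$. Simplices are spherical residues; the simplex with residue $R_J(x)=\{y:\delta(x,y)\in W_J\}$ ($W_J$ finite) has cotype $J$. For simplices $a,b$ with residues $\mathcal{A},\mathcal{B}$, $\delta(a,b)$ is the unique minimal length element of $\{\delta(x,y):x\in\mathcal{A},y\in\mathcal{B}\}$. Type-preserving means preserving $\delta$; Weyl-transitive means any two pairs of chambers with equal Weyl distance are mapped to each other by an element of $G$. $G$ has the compact-open topology; a compact open subgroup $U$ is tidy for $g$ if it minimizes $|gUg^{-1}:gUg^{-1}\cap U|$. For spherical $I\subseteq S$, $w\in W$ is $I$-straight if $w$ is of minimal length in $W_IwW_I$, $wIw^{-1}=I$, and $\ell(w^n)=n\,\ell(w)$ for all $n\in\mathbb{N}$. *)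

theory Defs
  imports "HOL-Analysis.Analysis" "HOL-Algebra.Group" "HOL-Algebra.Generated_Groups"
begin

definition wprod :: "('w, 'b) monoid_scheme \<Rightarrow> 'w list \<Rightarrow> 'w" where
  "wprod W ws = foldr (\<lambda>a b. a \<otimes>\<^bsub>W\<^esub> b) ws \<one>\<^bsub>W\<^esub>"

definition wlen :: "('w, 'b) monoid_scheme \<Rightarrow> 'w set \<Rightarrow> 'w \<Rightarrow> nat" where
  "wlen W S w = (LEAST n. \<exists>ws. length ws = n \<and> set ws \<subseteq> S \<and> wprod W ws = w)"

text \<open>(W,S) is a Coxeter system: W is a group generated by a finite set S of
  involutions satisfying the exchange condition (equivalent to the Coxeter
  presentation by Bourbaki / Abramenko--Brown Thm 2.72).\<close>
definition coxeter_system :: "('w, 'b) monoid_scheme \<Rightarrow> 'w set \<Rightarrow> bool" where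
  "coxeter_system W S \<longleftrightarrow> group W \<and> S \<subseteq> carrier W \<and> finite S \<and>
     generate W S = carrier W \<and>
     (\<forall>s\<in>S. s \<noteq> \<one>\<^bsub>W\<^esub> \<and> s \<otimes>\<^bsub>W\<^esub> s = \<one>\<^bsub>W\<^esub>) \<and>
     (\<forall>ws s. set ws \<subseteq> S \<longrightarrow> s \<in> S \<longrightarrow> wlen W S (wprod W ws) = length ws \<longrightarrow>
        wlen W S (s \<otimes>\<^bsub>W\<^esub> wprod W ws) < length ws \<longrightarrow>
        (\<exists>i<length ws. s \<otimes>\<^bsub>W\<^esub> wprod W ws = wprod W (take i ws @ drop (Suc i) ws)))"

definition parabolic :: "('w, 'b) monoid_scheme \<Rightarrow> 'w set \<Rightarrow> 'w set" where
  "parabolic W J = generate W J"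

definition spherical :: "('w, 'b) monoid_scheme \<Rightarrow> 'w set \<Rightarrow> 'w set \<Rightarrow> bool" where
  "spherical W S J \<longleftrightarrow> J \<subseteq> S \<and> finite (parabolic W J)"

definition straight :: "('w, 'b) monoid_scheme \<Rightarrow> 'w set \<Rightarrow> 'w set \<Rightarrow> 'w \<Rightarrow> bool" where
  "straight W S I w \<longleftrightarrow> w \<in> carrier W \<and>
     (\<forall>u\<in>parabolic W I. \<forall>v\<in>parabolic W I.
        wlen W S w \<le> wlen W S (u \<otimes>\<^bsub>W\<^esub> w \<otimes>\<^bsub>W\<^esub> v)) \<and>
     (\<lambda>i. w \<otimes>\<^bsub>W\<^esub> i \<otimes>\<^bsub>W\<^esub> inv\<^bsub>W\<^esub> w) ` I = I \<and>
     (\<forall>n::nat. wlen W S (w [^]\<^bsub>W\<^esub> n) = n * wlen W S w)"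

section \<open>Buildings (W-metric definition, Abramenko--Brown Def. 5.1)\<close>

definition building ::
  "('w, 'b) monoid_scheme \<Rightarrow> 'w set \<Rightarrow> 'c set \<Rightarrow> ('c \<Rightarrow> 'c \<Rightarrow> 'w) \<Rightarrow> bool" where
  "building W S C \<delta> \<longleftrightarrow> coxeter_system W S \<and> C \<noteq> {} \<and>
     (\<forall>x\<in>C. \<forall>y\<in>C. \<delta> x y \<in> carrier W) \<and>
     (\<forall>x\<in>C. \<forall>y\<in>C. \<delta> x y = \<one>\<^bsub>W\<^esub> \<longleftrightarrow> x = y) \<and>
     (\<forall>x\<in>C. \<forall>y\<in>C. \<forall>x'\<in>C. \<forall>s\<in>S. \<delta> x' x = s \<longrightarrow>
        (\<delta> x' y = s \<otimes>\<^bsub>W\<^esub> \<delta> x y \<or> \<delta> x' y = \<delta> x y) \<and>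
        (wlen W S (s \<otimes>\<^bsub>W\<^esub> \<delta> x y) = wlen W S (\<delta> x y) + 1 \<longrightarrow>
           \<delta> x' y = s \<otimes>\<^bsub>W\<^esub> \<delta> x y)) \<and>
     (\<forall>x\<in>C. \<forall>y\<in>C. \<forall>s\<in>S. \<exists>x'\<in>C. \<delta> x' x = s \<and> \<delta> x' y = s \<otimes>\<^bsub>W\<^esub> \<delta> x y)"

text \<open>Thick: every panel contains at least three chambers, i.e. every chamber has
  at least two s-adjacent chambers. Locally finite: every panel is finite.\<close>
definition thick :: "'w set \<Rightarrow> 'c set \<Rightarrow> ('c \<Rightarrow> 'c \<Rightarrow> 'w) \<Rightarrow> bool" where
  "thick S C \<delta> \<longleftrightarrow> (\<forall>x\<in>C. \<forall>s\<in>S. \<not> finite {y\<in>C. \<delta> x y = s} \<or> card {y\<in>C. \<delta> x y = s} \<ge> 2)"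

definition locally_finite :: "'w set \<Rightarrow> 'c set \<Rightarrow> ('c \<Rightarrow> 'c \<Rightarrow> 'w) \<Rightarrow> bool" where
  "locally_finite S C \<delta> \<longleftrightarrow> (\<forall>x\<in>C. \<forall>s\<in>S. finite {y\<in>C. \<delta> x y = s})"

text \<open>Residues (simplices) and the Weyl distance between simplices.\<close>
definition residue ::
  "('w, 'b) monoid_scheme \<Rightarrow> 'c set \<Rightarrow> ('c \<Rightarrow> 'c \<Rightarrow> 'w) \<Rightarrow> 'w set \<Rightarrow> 'c \<Rightarrow> 'c set" where
  "residue W C \<delta> J x = {y\<in>C. \<delta> x y \<in> parabolic W J}"

definition simplex_dist ::
  "('w, 'b) monoid_scheme \<Rightarrow> 'w set \<Rightarrow> ('c \<Rightarrow> 'c \<Rightarrow> 'w) \<Rightarrow> 'c set \<Rightarrow> 'c set \<Rightarrow> 'w" where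
  "simplex_dist W S \<delta> A B =
     (THE w. w \<in> {\<delta> x y | x y. x \<in> A \<and> y \<in> B} \<and>
        (\<forall>v\<in>{\<delta> x y | x y. x \<in> A \<and> y \<in> B}. wlen W S w \<le> wlen W S v))"

text \<open>Permutations of C are represented as extensional functions (undefined off C).\<close>
definition pcomp :: "'c set \<Rightarrow> ('c \<Rightarrow> 'c) \<Rightarrow> ('c \<Rightarrow> 'c) \<Rightarrow> 'c \<Rightarrow> 'c" where
  "pcomp C f g = restrict (f \<circ> g) C"

definition pinv :: "'c set \<Rightarrow> ('c \<Rightarrow> 'c) \<Rightarrow> 'c \<Rightarrow> 'c" where
  "pinv C f = restrict (inv_into C f) C"

definition pid :: "'c set \<Rightarrow> 'c \<Rightarrow> 'c" where
  "pid C = restrict id C"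

definition tp_aut :: "'c set \<Rightarrow> ('c \<Rightarrow> 'c \<Rightarrow> 'w) \<Rightarrow> ('c \<Rightarrow> 'c) set" where
  "tp_aut C \<delta> = {f \<in> extensional C. bij_betw f C C \<and> (\<forall>x\<in>C. \<forall>y\<in>C. \<delta> (f x) (f y) = \<delta> x y)}"

definition perm_subgroup :: "'c set \<Rightarrow> ('c \<Rightarrow> 'c) set \<Rightarrow> ('c \<Rightarrow> 'c) set \<Rightarrow> bool" where
  "perm_subgroup C H G \<longleftrightarrow> H \<subseteq> G \<and> pid C \<in> H \<and>
     (\<forall>f\<in>H. \<forall>g\<in>H. pcomp C f g \<in> H) \<and> (\<forall>f\<in>H. pinv C f \<in> H)"

text \<open>Compact-open topology; chambers carry the discrete topology, so this is the
  topology of pointwise convergence, i.e. the product topology.\<close>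
definition aut_topology :: "'c set \<Rightarrow> ('c \<Rightarrow> 'c) topology" where
  "aut_topology C = product_topology (\<lambda>_. discrete_topology C) C"

definition weyl_transitive :: "'c set \<Rightarrow> ('c \<Rightarrow> 'c \<Rightarrow> 'w) \<Rightarrow> ('c \<Rightarrow> 'c) set \<Rightarrow> bool" where
  "weyl_transitive C \<delta> G \<longleftrightarrow> (\<forall>x\<in>C. \<forall>y\<in>C. \<forall>x'\<in>C. \<forall>y'\<in>C.
     \<delta> x y = \<delta> x' y' \<longrightarrow> (\<exists>g\<in>G. g x = x' \<and> g y = y'))"

definition compact_open_subgroup :: "'c set \<Rightarrow> ('c \<Rightarrow> 'c) set \<Rightarrow> ('c \<Rightarrow> 'c) set \<Rightarrow> bool" where
  "compact_open_subgroup C G U \<longleftrightarrow> perm_subgroup C U G \<and>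
     compactin (aut_topology C) U \<and> openin (subtopology (aut_topology C) G) U"

definition conj_index :: "'c set \<Rightarrow> ('c \<Rightarrow> 'c) \<Rightarrow> ('c \<Rightarrow> 'c) set \<Rightarrow> nat" where
  "conj_index C g U =
     (let V = (\<lambda>u. pcomp C (pcomp C g u) (pinv C g)) ` U
      in card ((\<lambda>h. (\<lambda>k. pcomp C h k) ` (V \<inter> U)) ` V))"

definition tidy :: "'c set \<Rightarrow> ('c \<Rightarrow> 'c) set \<Rightarrow> ('c \<Rightarrow> 'c) \<Rightarrow> ('c \<Rightarrow> 'c) set \<Rightarrow> bool" where
  "tidy C G g U \<longleftrightarrow> compact_open_subgroup C G U \<and>
     (\<forall>V. compact_open_subgroup C G V \<longrightarrow> conj_index C g U \<le> conj_index C g V)"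

definition stabilizer :: "('c \<Rightarrow> 'c) set \<Rightarrow> 'c set \<Rightarrow> ('c \<Rightarrow> 'c) set" where
  "stabilizer G A = {h \<in> G. h ` A = A}"

end

theory Submission
  imports Defs "HOL-Algebra.Coset" "HOL-Library.Sublist"
begin

text \<open>Write \<open>R\<close> for the residue, \<open>U\<close> for its stabiliser, \<open>A = W\<^sub>J\<close>, \<open>w = \<delta>(R, g R)\<close>.

  If \<open>w\<close> is straight, then \<open>U\<close> has conjugation index at most \<open>q\<^sub>w\<close>, the number of chambers at
  distance \<open>w\<close> from a given one, while the index for \<open>g\<^sup>n\<close> is at least \<open>q\<^sub>w\<^sup>n\<close> up to the constant
  \<open>|R|\<close>. For any compact open \<open>V\<close> the index for \<open>g\<^sup>n\<close> is at most the \<open>n\<close>-th power of the index for \<open>g\<close>,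
  and passing from \<open>V\<close> to \<open>U\<close> costs a constant; taking \<open>n\<close>-th roots, \<open>U\<close> is minimal.

  Conversely, compare a minimising \<open>U\<close> with the stabilisers of \<open>R, g R, \<dots>, g\<^sup>n R\<close>. Minimality shows
  that \<open>G\<close> is transitive on sequences of \<open>n + 1\<close> residues whose consecutive distances are \<open>w\<close>, so all
  chamber paths with steps in \<open>A w A\<close> have end-to-end distance in the single double coset
  \<open>A w\<^sup>n A\<close>. As \<open>A\<close> is finite, this forces \<open>w\<close> to normalise \<open>A\<close>. If the length of some \<open>w\<^sup>n\<close> dropped,
  thickness would give a path whose end-to-end distance exhibits an element of \<open>A w A\<close> shorter
  than \<open>w\<close>.\<close>

section \<open>Words and lengths; distances in buildings\<close>

text \<open>Every coset count here is a count of residues: for \<open>h\<close> in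
  \<open>g U g^-1\<close> the coset \<open>h U\<close> is determined by the residue
  \<open>h R\<close>, so the index of \<open>U\<close> is the size of the orbit of \<open>R\<close>
  under the stabiliser of \<open>g R\<close>. As \<open>conj_index\<close> is a \<open>card\<close>,
  an infinite index would read as 0 and spoil the minimum; compactness must first make every index
  genuine. Indices are therefore carried as finite covers by translates, which compose and conjugate
  freely.

  The converse rests on a freedom in buildings: a chamber can be prepended so that the distances
  multiply, whether or not lengths add. If lengths fail to add, thickness also realises a shortened
  product, by a chamber at the same distance from the old first one. Minimality confines both
  outcomes to one double coset, and comparing them yields the algebra.\<close>

locale coxeter_group =
  fixes W :: "('w, 'b) monoid_scheme" (structure) and S :: "'w set"
  assumes coxeter: "coxeter_system W S"
begin

sublocale group W
  using coxeter by (simp add: coxeter_system_def)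

abbreviation len :: "'w \<Rightarrow> nat" where "len \<equiv> wlen W S"

lemma S_carrier: "S \<subseteq> carrier W"
  using coxeter by (simp add: coxeter_system_def)

lemma S_closed [simp]: "s \<in> S \<Longrightarrow> s \<in> carrier W"
  using S_carrier by blast

lemma gen_sq: "s \<in> S \<Longrightarrow> s \<otimes> s = \<one>"
  using coxeter by (simp add: coxeter_system_def)

lemma gen_neq_one: "s \<in> S \<Longrightarrow> s \<noteq> \<one>"
  using coxeter by (simp add: coxeter_system_def)

lemma gen_inv [simp]: "s \<in> S \<Longrightarrow> inv s = s"
  by (simp add: gen_sq inv_equality)

lemma gen_cancel [simp]: "\<lbrakk>s \<in> S; v \<in> carrier W\<rbrakk> \<Longrightarrow> s \<otimes> (s \<otimes> v) = v"
  by (simp flip: m_assoc add: gen_sq)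

lemma exchange:
  assumes "set ws \<subseteq> S" "s \<in> S" "len (wprod W ws) = length ws" "len (s \<otimes> wprod W ws) < length ws"
  obtains i where "i < length ws" "s \<otimes> wprod W ws = wprod W (take i ws @ drop (Suc i) ws)"
  using coxeter assms unfolding coxeter_system_def by blast

lemma wprod_Nil [simp]: "wprod W [] = \<one>"
  and wprod_Cons [simp]: "wprod W (s # ws) = s \<otimes> wprod W ws"
  by (simp_all add: wprod_def)

lemma wprod_closed [simp]: "set ws \<subseteq> S \<Longrightarrow> wprod W ws \<in> carrier W"
  by (induction ws) auto

lemma wprod_append: "set us \<subseteq> S \<Longrightarrow> set vs \<subseteq> S \<Longrightarrow> wprod W (us @ vs) = wprod W us \<otimes> wprod W vs"
  by (induction us) (auto simp: m_assoc)

lemma wprod_rev: "set ws \<subseteq> S \<Longrightarrow> wprod W (rev ws) = inv (wprod W ws)"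
  by (induction ws) (auto simp: wprod_append inv_mult_group)

lemma parabolic_subgroup: "J \<subseteq> S \<Longrightarrow> subgroup (parabolic W J) W"
  unfolding parabolic_def using S_carrier by (intro generate_is_subgroup) auto

lemma parabolic_word:
  assumes "J \<subseteq> S"
  shows "v \<in> parabolic W J \<longleftrightarrow> (\<exists>ws. set ws \<subseteq> J \<and> wprod W ws = v)"
proof
  assume "v \<in> parabolic W J"
  then have "v \<in> generate W J" by (simp add: parabolic_def)
  then show "\<exists>ws. set ws \<subseteq> J \<and> wprod W ws = v"
  proof induction
    case one
    show ?case by (rule exI[of _ "[]"]) simp
  next
    case (incl h)
    then show ?case using assms by (intro exI[of _ "[h]"]) auto
  next
    case (inv h)
    then show ?case using assms by (intro exI[of _ "[h]"]) auto
  next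
    case (eng h1 h2)
    then obtain us vs where "set us \<subseteq> J" "wprod W us = h1" "set vs \<subseteq> J" "wprod W vs = h2"
      by auto
    then show ?case using assms wprod_append[of us vs] by (intro exI[of _ "us @ vs"]) auto
  qed
next
  assume "\<exists>ws. set ws \<subseteq> J \<and> wprod W ws = v"
  then obtain ws where "set ws \<subseteq> J" "wprod W ws = v" by blast
  moreover have "wprod W ws \<in> parabolic W J" if "set ws \<subseteq> J" for ws
    using that
  proof (induction ws)
    case Nil
    then show ?case using parabolic_subgroup[OF assms] by (simp add: subgroup.one_closed)
  next
    case (Cons s ws)
    then have "s \<in> parabolic W J" by (simp add: parabolic_def generate.incl)
    with Cons show ?case using parabolic_subgroup[OF assms] by (simp add: subgroup.m_closed)
  qed
  ultimately show "v \<in> parabolic W J" by blast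
qed

lemma parabolic_S: "parabolic W S = carrier W"
  using coxeter by (simp add: coxeter_system_def parabolic_def)

lemma len_le: "set ws \<subseteq> S \<Longrightarrow> len (wprod W ws) \<le> length ws"
  unfolding wlen_def by (rule Least_le) blast

lemma reduced_word:
  assumes "v \<in> carrier W"
  obtains ws where "set ws \<subseteq> S" "wprod W ws = v" "length ws = len v"
proof -
  have "\<exists>n ws. length ws = n \<and> set ws \<subseteq> S \<and> wprod W ws = v"
    using assms parabolic_word[of S v] parabolic_S by blast
  from LeastI_ex[OF this] show ?thesis using that unfolding wlen_def by blast
qed

lemma len_one [simp]: "len \<one> = 0"
  using len_le[of "[]"] by simp

lemma len_eq_0: "v \<in> carrier W \<Longrightarrow> len v = 0 \<longleftrightarrow> v = \<one>"
  by (metis reduced_word length_0_conv wprod_Nil len_one)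

lemma len_inv_le: "v \<in> carrier W \<Longrightarrow> len (inv v) \<le> len v"
  by (metis reduced_word len_le length_rev set_rev wprod_rev)

lemma len_inv: "v \<in> carrier W \<Longrightarrow> len (inv v) = len v"
  by (metis inv_closed inv_inv len_inv_le order_antisym)

lemma len_mult_le: "\<lbrakk>u \<in> carrier W; v \<in> carrier W\<rbrakk> \<Longrightarrow> len (u \<otimes> v) \<le> len u + len v"
  by (metis reduced_word len_le length_append le_sup_iff set_append wprod_append)

lemma len_gen_le: "s \<in> S \<Longrightarrow> len s \<le> 1"
  using len_le[of "[s]"] by simp

lemma len_gen: "s \<in> S \<Longrightarrow> len s = 1"
  using len_gen_le[of s] len_eq_0[of s] gen_neq_one[of s] by auto

lemma len_left_le: "\<lbrakk>s \<in> S; v \<in> carrier W\<rbrakk> \<Longrightarrow> len (s \<otimes> v) \<le> len v + 1"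
  using len_mult_le[of s v] len_gen_le[of s] by simp

lemma len_right_le: "\<lbrakk>s \<in> S; v \<in> carrier W\<rbrakk> \<Longrightarrow> len (v \<otimes> s) \<le> len v + 1"
  using len_mult_le[of v s] len_gen_le[of s] by simp

lemma len_le_left: "\<lbrakk>s \<in> S; v \<in> carrier W\<rbrakk> \<Longrightarrow> len v \<le> len (s \<otimes> v) + 1"
  using len_left_le[of s "s \<otimes> v"] by simp

lemma left_descent:
  assumes "v \<in> carrier W" "len v \<noteq> 0"
  obtains s u where "s \<in> S" "u \<in> carrier W" "v = s \<otimes> u" "len v = len u + 1"
proof -
  obtain ws where ws: "set ws \<subseteq> S" "wprod W ws = v" "length ws = len v"
    using reduced_word[OF assms(1)] .
  then obtain s us where s: "ws = s # us" using assms(2) by (cases ws) auto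
  then have us: "s \<in> S" "set us \<subseteq> S" "v = s \<otimes> wprod W us" using ws by auto
  moreover have "len v = len (wprod W us) + 1"
    using len_le[of us] len_left_le[of s "wprod W us"] us ws s by auto
  ultimately show ?thesis using that[of s "wprod W us"] wprod_closed by blast
qed

lemma right_descent:
  assumes "v \<in> carrier W" "len v \<noteq> 0"
  obtains s u where "s \<in> S" "u \<in> carrier W" "v = u \<otimes> s" "len v = len u + 1"
proof -
  have "inv v \<in> carrier W" "len (inv v) \<noteq> 0" using assms by (simp_all add: len_inv)
  then obtain s u where su: "s \<in> S" "u \<in> carrier W" "inv v = s \<otimes> u" "len (inv v) = len u + 1"
    by (rule left_descent)
  then have "v = inv u \<otimes> s"
    using assms(1) by (metis S_closed gen_inv inv_inv inv_mult_group)
  moreover have "len v = len (inv u) + 1"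
    using su(4) len_inv[OF assms(1)] len_inv[OF su(2)] by simp
  ultimately show ?thesis using that[of s "inv u"] su by blast
qed

lemma len_induct [consumes 1, case_names one step]:
  assumes "v \<in> carrier W" "P \<one>"
    and "\<And>s u. \<lbrakk>s \<in> S; u \<in> carrier W; len (s \<otimes> u) = len u + 1; P u\<rbrakk> \<Longrightarrow> P (s \<otimes> u)"
  shows "P v"
  using assms(1)
proof (induction "len v" arbitrary: v)
  case 0
  then show ?case using assms(2) by (metis len_eq_0)
next
  case (Suc n)
  then show ?case using assms(3) left_descent[of v]
    by (metis Suc_inject Suc_eq_plus1 nat.distinct(1))
qed

lemma gen_mult_induct [consumes 2, case_names one step]:
  assumes "J \<subseteq> S" "v \<in> parabolic W J" "P \<one>"
    and "\<And>s u. \<lbrakk>s \<in> J; u \<in> parabolic W J; P u\<rbrakk> \<Longrightarrow> P (s \<otimes> u)"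
  shows "P v"
proof -
  obtain ws where "set ws \<subseteq> J" "wprod W ws = v" using assms parabolic_word by blast
  moreover have "P (wprod W ws)" if "set ws \<subseteq> J" for ws
    using that
  proof (induction ws)
    case (Cons s ws)
    then show ?case using assms(4) parabolic_word[OF assms(1)] by auto
  qed (simp add: assms(3))
  ultimately show ?thesis by blast
qed

end

section \<open>The calculus of Weyl distances\<close>

locale weyl_building = coxeter_group W S
  for W :: "('w, 'b) monoid_scheme" (structure) and S :: "'w set" +
  fixes C :: "'c set" and \<delta> :: "'c \<Rightarrow> 'c \<Rightarrow> 'w"
  assumes building: "building W S C \<delta>"
begin

lemma C_nonempty: "C \<noteq> {}"
  using building unfolding building_def by (elim conjE)

lemma dist_closed [simp]:
  assumes "x \<in> C" "y \<in> C"
  shows "\<delta> x y \<in> carrier W"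
proof -
  have "\<forall>x\<in>C. \<forall>y\<in>C. \<delta> x y \<in> carrier W"
    using building unfolding building_def by (elim conjE)
  then show ?thesis using assms by blast
qed

lemma dist_eq_one:
  assumes "x \<in> C" "y \<in> C"
  shows "\<delta> x y = \<one> \<longleftrightarrow> x = y"
proof -
  have "\<forall>x\<in>C. \<forall>y\<in>C. \<delta> x y = \<one> \<longleftrightarrow> x = y"
    using building unfolding building_def by (elim conjE)
  then show ?thesis using assms by blast
qed

lemma left_step_aux:
  assumes "x \<in> C" "y \<in> C" "x' \<in> C" "s \<in> S" "\<delta> x' x = s"
  shows "(\<delta> x' y = s \<otimes> \<delta> x y \<or> \<delta> x' y = \<delta> x y) \<and>
    (len (s \<otimes> \<delta> x y) = len (\<delta> x y) + 1 \<longrightarrow> \<delta> x' y = s \<otimes> \<delta> x y)"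
proof -
  have "\<forall>x\<in>C. \<forall>y\<in>C. \<forall>x'\<in>C. \<forall>s\<in>S. \<delta> x' x = s \<longrightarrow>
        (\<delta> x' y = s \<otimes> \<delta> x y \<or> \<delta> x' y = \<delta> x y) \<and>
        (len (s \<otimes> \<delta> x y) = len (\<delta> x y) + 1 \<longrightarrow> \<delta> x' y = s \<otimes> \<delta> x y)"
    using building unfolding building_def by (elim conjE)
  then show ?thesis using assms by blast
qed

lemma left_step: "\<lbrakk>x \<in> C; y \<in> C; x' \<in> C; s \<in> S; \<delta> x' x = s\<rbrakk> \<Longrightarrow>
    \<delta> x' y = s \<otimes> \<delta> x y \<or> \<delta> x' y = \<delta> x y"
  using left_step_aux by (rule conjunct1)

lemma left_up:
  assumes "x \<in> C" "y \<in> C" "x' \<in> C" "s \<in> S" "\<delta> x' x = s" "len (s \<otimes> \<delta> x y) = len (\<delta> x y) + 1"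
  shows "\<delta> x' y = s \<otimes> \<delta> x y"
  using conjunct2[OF left_step_aux[OF assms(1-5)]] assms(6) by (rule mp)

lemma left_exist:
  assumes "x \<in> C" "y \<in> C" "s \<in> S"
  shows "\<exists>x'\<in>C. \<delta> x' x = s \<and> \<delta> x' y = s \<otimes> \<delta> x y"
proof -
  have "\<forall>x\<in>C. \<forall>y\<in>C. \<forall>s\<in>S. \<exists>x'\<in>C. \<delta> x' x = s \<and> \<delta> x' y = s \<otimes> \<delta> x y"
    using building unfolding building_def by (elim conjE)
  then show ?thesis using assms by blast
qed

lemma dist_self [simp]: "x \<in> C \<Longrightarrow> \<delta> x x = \<one>"
  by (simp add: dist_eq_one)

text \<open>The axioms vary only the first argument. Symmetry comes from moving from
  \<open>y\<close> to \<open>x\<close> and watching the distance to \<open>x\<close>, which becomes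
  the identity.\<close>

lemma adj_sym:
  assumes "x \<in> C" "y \<in> C" "s \<in> S" "\<delta> x y = s"
  shows "\<delta> y x = s"
proof -
  have "\<delta> x x = s \<otimes> \<delta> y x \<or> \<delta> x x = \<delta> y x"
    by (rule left_step) (use assms in auto)
  moreover have "\<delta> y x \<noteq> \<one>" using assms dist_eq_one gen_neq_one by metis
  ultimately have "s \<otimes> \<delta> y x = \<one>" using dist_self[OF assms(1)] by auto
  then have "s \<otimes> (s \<otimes> \<delta> y x) = s" using assms(3) by simp
  then show ?thesis using gen_cancel[of s "\<delta> y x"] assms(1-3) by simp
qed

text \<open>Induction on a reduced word of \<open>u\<close>: moving from \<open>x\<close> one letter
  towards \<open>z\<close> strips the first letter, and putting it back raises the length, the case
  in which the axioms determine the distance.\<close>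

lemma left_mult:
  assumes "u \<in> carrier W" "x \<in> C" "y \<in> C" "z \<in> C" "\<delta> x z = u" "\<delta> z y = v"
    "len (u \<otimes> v) = len u + len v"
  shows "\<delta> x y = u \<otimes> v"
  using assms
proof (induction arbitrary: x rule: len_induct)
  case one
  then have "x = z" using dist_eq_one by blast
  then show ?case using one dist_closed by auto
next
  case (step s u)
  have v: "v \<in> carrier W" using step dist_closed by blast
  obtain x1 where x1: "x1 \<in> C" "\<delta> x1 x = s" "\<delta> x1 z = u"
    using left_exist[of x z s] step by auto
  have l: "len (u \<otimes> v) = len u + len v"
    using len_mult_le[of u v] len_left_le[of s "u \<otimes> v"] step v by (simp add: m_assoc)
  have xy: "\<delta> x1 y = u \<otimes> v" by (rule step.IH) (use step x1 l in auto)
  have "\<delta> x x1 = s" using adj_sym x1 step by blast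
  moreover have "len (s \<otimes> (u \<otimes> v)) = len (u \<otimes> v) + 1"
    using step v l by (simp add: m_assoc)
  ultimately show ?case using left_up[of x1 y x s] step x1 v xy by (simp add: m_assoc)
qed

lemma dist_inv:
  assumes "x \<in> C" "y \<in> C"
  shows "\<delta> y x = inv (\<delta> x y)"
proof -
  have "\<delta> y x = inv v" if "v \<in> carrier W" "x \<in> C" "\<delta> x y = v" for x v
    using that
  proof (induction arbitrary: x rule: len_induct)
    case one
    then show ?case using dist_eq_one assms by auto
  next
    case (step s u)
    obtain x1 where x1: "x1 \<in> C" "\<delta> x1 x = s" "\<delta> x1 y = u"
      using left_exist[of x y s] step assms by auto
    have "len (inv u \<otimes> s) = len (inv u) + len s"
      using step len_inv[of "s \<otimes> u"] by (simp add: inv_mult_group len_inv len_gen)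
    then have "\<delta> y x = inv u \<otimes> s"
      using left_mult[of "inv u" y x x1 s] step x1 assms by auto
    then show ?case using step by (simp add: inv_mult_group)
  qed
  then show ?thesis using assms by simp
qed

text \<open>No additivity of lengths is assumed. The letters of a reduced word of \<open>v\<close>
  are prepended one at a time: the product with \<open>\<delta> x y\<close> is chosen at each step,
  while the distance to \<open>x\<close> is forced because there the length grows. All later walks
  with prescribed total distance come from this freedom.\<close>

lemma left_exist_mult:
  assumes "v \<in> carrier W" "x \<in> C" "y \<in> C"
  shows "\<exists>x'\<in>C. \<delta> x' x = v \<and> \<delta> x' y = v \<otimes> \<delta> x y"
  using assms
proof (induction rule: len_induct)
  case one
  then show ?case by (intro bexI[of _ x]) auto
next
  case (step s u)
  then obtain z where z: "z \<in> C" "\<delta> z x = u" "\<delta> z y = u \<otimes> \<delta> x y" by blast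
  obtain x' where x': "x' \<in> C" "\<delta> x' z = s" "\<delta> x' y = s \<otimes> (u \<otimes> \<delta> x y)"
    using left_exist[of z y s] z step by auto
  have "\<delta> x' x = s \<otimes> u"
    using left_up[of z x x' s] x' z step by simp
  then show ?case using x' step by (intro bexI[of _ x']) (auto simp: m_assoc)
qed

text \<open>Obtained by stepping back from \<open>x\<close> by \<open>inv u\<close>; again
  \<open>u\<close> and \<open>v\<close> may cancel against each other.\<close>

lemma split_dist:
  assumes "u \<in> carrier W" "v \<in> carrier W" "x \<in> C" "y \<in> C" "\<delta> x y = u \<otimes> v"
  obtains z where "z \<in> C" "\<delta> x z = u" "\<delta> z y = v"
proof -
  obtain z where z: "z \<in> C" "\<delta> z x = inv u" "\<delta> z y = inv u \<otimes> (u \<otimes> v)"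
    using left_exist_mult[of "inv u" x y] assms by auto
  have "\<delta> x z = u" using dist_inv[of z x] z assms by simp
  moreover have "\<delta> z y = v" using z assms by (simp flip: m_assoc)
  ultimately show ?thesis using that z by blast
qed

lemma exists_dist: "\<lbrakk>v \<in> carrier W; y \<in> C\<rbrakk> \<Longrightarrow> \<exists>x\<in>C. \<delta> x y = v"
  using left_exist_mult by blast

text \<open>If the first steps from \<open>x\<close> towards \<open>z\<close> and \<open>z'\<close>
  differed, they would be \<open>s\<close>-adjacent, and the axiom for increasing length would give
  them different distances to \<open>y\<close>.\<close>

lemma split_unique:
  assumes "u \<in> carrier W" "x \<in> C" "y \<in> C" "z \<in> C" "z' \<in> C"
    "\<delta> x z = u" "\<delta> x z' = u" "\<delta> z y = v" "\<delta> z' y = v" "len (u \<otimes> v) = len u + len v"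
  shows "z = z'"
  using assms
proof (induction arbitrary: x rule: len_induct)
  case one
  then show ?case using dist_eq_one by metis
next
  case (step s u)
  have v: "v \<in> carrier W" using step dist_closed by blast
  have l: "len (u \<otimes> v) = len u + len v"
    using len_mult_le[of u v] len_left_le[of s "u \<otimes> v"] step v by (simp add: m_assoc)
  obtain x1 where x1: "x1 \<in> C" "\<delta> x x1 = s" "\<delta> x1 z = u"
    using split_dist[of s u x z] step by auto
  obtain x2 where x2: "x2 \<in> C" "\<delta> x x2 = s" "\<delta> x2 z' = u"
    using split_dist[of s u x z'] step by auto
  have xy: "\<delta> x1 y = u \<otimes> v" "\<delta> x2 y = u \<otimes> v"
    by (rule left_mult[of u _ y z]; use step x1 l in auto)
      (rule left_mult[of u _ y z']; use step x2 l in auto)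
  have "\<delta> x1 x2 = \<one> \<or> \<delta> x1 x2 = s"
    using left_step[of x x2 x1 s] x1 x2 step adj_sym[of x x1 s] gen_sq by metis
  moreover have "\<delta> x1 x2 \<noteq> s"
  proof
    assume "\<delta> x1 x2 = s"
    moreover have "len (s \<otimes> (u \<otimes> v)) = len (u \<otimes> v) + 1"
      using step v l by (simp add: m_assoc)
    ultimately have "u \<otimes> v = s \<otimes> (u \<otimes> v)"
      using left_up[of x2 y x1 s] x1 x2 xy step by auto
    with \<open>len (s \<otimes> (u \<otimes> v)) = len (u \<otimes> v) + 1\<close> show False by simp
  qed
  ultimately have "x1 = x2" using dist_eq_one x1 x2 by blast
  show ?case by (rule step.IH[of x1]) (use \<open>x1 = x2\<close> x1 x2 step l in auto)
qed

lemma parabolic_left: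
  assumes "J \<subseteq> S" "u \<in> parabolic W J" "x \<in> C" "y \<in> C" "z \<in> C" "\<delta> x y = u"
  shows "\<exists>u'\<in>parabolic W J. \<delta> x z = u' \<otimes> \<delta> y z"
  using assms
proof (induction arbitrary: x rule: gen_mult_induct)
  case one
  then show ?case using dist_eq_one parabolic_subgroup[OF assms(1)]
    by (intro bexI[of _ \<one>]) (auto simp: subgroup.one_closed)
next
  case (step s u)
  note sub = parabolic_subgroup[OF assms(1)]
  have s: "s \<in> S" "s \<in> parabolic W J" and u: "u \<in> carrier W"
    using step assms(1) subgroup.mem_carrier[OF sub] by (auto simp: parabolic_def generate.incl)
  obtain x1 where x1: "x1 \<in> C" "\<delta> x x1 = s" "\<delta> x1 y = u"
    using split_dist[of s u x y] step s u by auto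
  then obtain u' where u': "u' \<in> parabolic W J" "\<delta> x1 z = u' \<otimes> \<delta> y z"
    using step by blast
  have "\<delta> x z = s \<otimes> \<delta> x1 z \<or> \<delta> x z = \<delta> x1 z"
    using left_step[of x1 z x s] x1 s step by blast
  moreover have "s \<otimes> \<delta> x1 z = (s \<otimes> u') \<otimes> \<delta> y z"
    using u' s step subgroup.mem_carrier[OF sub u'(1)] by (simp add: m_assoc)
  ultimately show ?case using u' s subgroup.m_closed[OF sub s(2) u'(1)] by metis
qed

lemma parabolic_right:
  assumes "J \<subseteq> S" "x \<in> C" "y \<in> C" "z \<in> C" "\<delta> x y \<in> parabolic W J"
  shows "\<exists>u\<in>parabolic W J. \<delta> z y = \<delta> z x \<otimes> u"
proof -
  note sub = parabolic_subgroup[OF assms(1)]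
  have "\<delta> y x \<in> parabolic W J"
    using assms dist_inv subgroup.m_inv_closed[OF sub] by metis
  then obtain u where u: "u \<in> parabolic W J" "\<delta> y z = u \<otimes> \<delta> x z"
    using parabolic_left[OF assms(1) _ assms(3,2,4)] by blast
  then have "u \<in> carrier W" using subgroup.mem_carrier[OF sub] by blast
  then have "\<delta> z y = \<delta> z x \<otimes> inv u"
    using u assms dist_inv[of y z] dist_inv[of x z] by (simp add: inv_mult_group)
  then show ?thesis using u subgroup.m_inv_closed[OF sub] by blast
qed

end

section \<open>Thick buildings\<close>

locale thick_building = weyl_building W S C \<delta>
  for W :: "('w, 'b) monoid_scheme" (structure) and S :: "'w set"
    and C :: "'c set" and \<delta> :: "'c \<Rightarrow> 'c \<Rightarrow> 'w" +
  assumes thick: "thick S C \<delta>"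
begin

lemma adj_trans:
  assumes "x \<in> C" "y \<in> C" "z \<in> C" "s \<in> S" "\<delta> x y = s" "\<delta> y z = s" "x \<noteq> z"
  shows "\<delta> x z = s"
proof -
  have "\<delta> x z = s \<otimes> \<delta> y z \<or> \<delta> x z = \<delta> y z"
    by (rule left_step) (use assms in auto)
  then have "\<delta> x z = \<one> \<or> \<delta> x z = s" using gen_sq[OF assms(4)] assms(6) by auto
  then show ?thesis using dist_eq_one[of x z] assms by auto
qed

text \<open>Compare galleries of the same reduced type from \<open>p\<close> and \<open>p'\<close> to \<open>y\<close>: where they first meet, one
  reads off a deletion in the word \<open>s v\<close>.\<close>
lemma equidistant_descent:
  assumes "v \<in> carrier W" "p \<in> C" "p' \<in> C" "y \<in> C" "s \<in> S"
    "\<delta> p p' = s" "\<delta> p y = v" "\<delta> p' y = v"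
  shows "len (s \<otimes> v) < len v"
  using assms
proof (induction "len v" arbitrary: v y)
  case 0
  then have "\<delta> p y = \<one>" "\<delta> p' y = \<one>" using len_eq_0 by metis+
  then have "p = p'" using dist_eq_one 0 by blast
  then show ?case using 0 gen_neq_one by (metis dist_self)
next
  case (Suc n)
  have "len v \<noteq> 0" using Suc by simp
  then obtain t u where tu: "t \<in> S" "u \<in> carrier W" "v = u \<otimes> t" "len v = len u + 1"
    using right_descent Suc(3) by blast
  obtain q where q: "q \<in> C" "\<delta> p q = u" "\<delta> q y = t"
    by (rule split_dist[of u t p y]) (use Suc tu in auto)
  obtain q' where q': "q' \<in> C" "\<delta> p' q' = u" "\<delta> q' y = t"
    by (rule split_dist[of u t p' y]) (use Suc tu in auto)
  show ?case
  proof (cases "q = q'")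
    case True
    have "len (s \<otimes> u) < len u"
      by (rule Suc.hyps(1)[of _ q]) (use Suc.prems Suc.hyps(2) tu q q' True in auto)
    moreover have "s \<otimes> v = (s \<otimes> u) \<otimes> t"
      using tu Suc.prems(5) by (simp add: m_assoc)
    ultimately show ?thesis
      using len_right_le[of t "s \<otimes> u"] tu Suc.prems(5) by simp
  next
    case False
    have "\<delta> y q = t" using adj_sym q tu Suc.prems by blast
    then have t: "\<delta> q' q = t"
      using adj_trans[of q' y q t] q q' tu Suc.prems False by blast
    \<comment> \<open>The galleries differ here: \<open>q\<close> and \<open>q'\<close> lie on the
      \<open>t\<close>-panel of \<open>y\<close>, so \<open>p'\<close> has distance \<open>v\<close>
      to \<open>q\<close> while \<open>p\<close> has distance \<open>u\<close>. The step from
      \<open>p\<close> to \<open>p'\<close> must then multiply by \<open>s\<close>, so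
      \<open>s v\<close> is the shorter element \<open>u\<close>.\<close>
    have "\<delta> p' q = u \<otimes> t"
      by (rule left_mult[of u _ _ q']) (use t q q' tu Suc.prems len_gen in auto)
    then have v: "\<delta> p' q = v" using tu by simp
    have "\<delta> p' p = s" using adj_sym Suc.prems by blast
    then have "\<delta> p' q = s \<otimes> \<delta> p q \<or> \<delta> p' q = \<delta> p q"
      by (intro left_step) (use q Suc.prems in auto)
    moreover have "v \<noteq> u" using tu(4) by auto
    ultimately have "v = s \<otimes> u" using v q(2) by auto
    then have "s \<otimes> v = u" using tu(2) Suc.prems(5) by simp
    then show ?thesis using tu(4) by simp
  qed
qed

lemma three_on_panel:
  assumes "x \<in> C" "s \<in> S"
  obtains p p' where "p \<in> C" "p' \<in> C" "p \<noteq> p'" "\<delta> p x = s" "\<delta> p' x = s"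
proof -
  let ?P = "{y \<in> C. \<delta> x y = s}"
  have "infinite ?P \<or> 2 \<le> card ?P" using thick assms unfolding thick_def by blast
  then obtain A where A: "A \<subseteq> ?P" "card A = 2"
  proof
    assume "infinite ?P"
    from infinite_arbitrarily_large[OF this, of 2] show thesis using that by blast
  next
    assume "2 \<le> card ?P"
    from obtain_subset_with_card_n[OF this] show thesis using that by metis
  qed
  from A(2) obtain p p' where "A = {p, p'}" "p \<noteq> p'" by (auto simp: card_2_iff)
  with A(1) have "p \<in> ?P" "p' \<in> ?P" "p \<noteq> p'" by blast+
  then show ?thesis using that adj_sym assms by blast
qed

text \<open>The exchange condition in \<^const>\<open>coxeter_system\<close> does not exclude equality here: the Klein four-group
  with its three involutions satisfies it. Thickness does: of three chambers on a panel, two have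
  the same distance to \<open>y\<close>.\<close>
lemma len_neq:
  assumes "s \<in> S" "v \<in> carrier W"
  shows "len (s \<otimes> v) \<noteq> len v"
proof
  assume eq: "len (s \<otimes> v) = len v"
  obtain y where y: "y \<in> C" using C_nonempty by blast
  obtain x where x: "x \<in> C" "\<delta> x y = v" using exists_dist assms y by blast
  obtain p p' where p: "p \<in> C" "p' \<in> C" "p \<noteq> p'" "\<delta> p x = s" "\<delta> p' x = s"
    using three_on_panel x assms by blast
  have "\<delta> x p' = s" using adj_sym p x assms by blast
  then have pp: "\<delta> p p' = s" using adj_trans[of p x p' s] p x assms by blast
  \<comment> \<open>Two \<open>s\<close>-adjacent chambers at a common distance \<open>v\<close> or
    \<open>s v\<close> would make the other of these two elements strictly shorter. With three
    chambers and two possible distances, some pair has a common one.\<close>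
  have *: False if "a \<in> C" "b \<in> C" "\<delta> a b = s" "\<delta> a y = \<delta> b y" "\<delta> a y \<in> {v, s \<otimes> v}" for a b
  proof -
    have "len (s \<otimes> \<delta> a y) < len (\<delta> a y)"
      by (rule equidistant_descent[of _ a b y]) (use that y assms in auto)
    then show False using that(5) eq assms by auto
  qed
  have "\<delta> p y = s \<otimes> v \<or> \<delta> p y = v"
    using left_step[of x y p s] p x y assms by auto
  moreover have "\<delta> p' y = s \<otimes> v \<or> \<delta> p' y = v"
    using left_step[of x y p' s] p x y assms by auto
  ultimately show False using *[of p p'] *[of p x] *[of p' x] p x pp by auto
qed

lemma len_left_cases:
  assumes "s \<in> S" "v \<in> carrier W"
  shows "len (s \<otimes> v) = len v + 1 \<or> len (s \<otimes> v) + 1 = len v"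
  using len_neq[OF assms] len_left_le[OF assms] len_le_left[OF assms] by auto

text \<open>Two chambers of the panel cannot both be at the shorter distance
  \<open>s \<delta> x y\<close>, by \<open>equidistant_descent\<close>; so of two chambers other
  than \<open>x\<close>, one keeps the distance of \<open>x\<close>.\<close>

lemma stuttering:
  assumes "s \<in> S" "x \<in> C" "y \<in> C" "len (s \<otimes> \<delta> x y) < len (\<delta> x y)"
  obtains p where "p \<in> C" "\<delta> p x = s" "\<delta> p y = \<delta> x y"
proof -
  obtain p p' where p: "p \<in> C" "p' \<in> C" "p \<noteq> p'" "\<delta> p x = s" "\<delta> p' x = s"
    using three_on_panel assms by blast
  have "\<delta> x p' = s" using adj_sym p assms by blast
  then have pp: "\<delta> p p' = s" using adj_trans[of p x p' s] p assms by blast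
  have "\<not> (\<delta> p y = s \<otimes> \<delta> x y \<and> \<delta> p' y = s \<otimes> \<delta> x y)"
    using equidistant_descent[of "s \<otimes> \<delta> x y" p p' y s] pp p assms by auto
  moreover have "\<delta> p y = s \<otimes> \<delta> x y \<or> \<delta> p y = \<delta> x y"
    using left_step[of x y p s] p assms by auto
  moreover have "\<delta> p' y = s \<otimes> \<delta> x y \<or> \<delta> p' y = \<delta> x y"
    using left_step[of x y p' s] p assms by auto
  ultimately show ?thesis using that p by blast
qed

text \<open>Walk away from \<open>p\<close> along a reduced word of \<open>u\<close> and stutter at the first letter that does not
  increase the distance to \<open>y\<close>.\<close>
lemma deletion_realised:
  assumes "u \<in> carrier W" "p \<in> C" "y \<in> C" "len (u \<otimes> \<delta> p y) < len u + len (\<delta> p y)"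
  shows "\<exists>z\<in>C. \<exists>u'\<in>carrier W. \<delta> z p = u \<and> \<delta> z y = u' \<otimes> \<delta> p y \<and> len u' < len u"
  using assms
proof (induction rule: len_induct)
  case one
  then show ?case by simp
next
  case (step s u)
  let ?v = "\<delta> p y"
  have v: "?v \<in> carrier W" using step by simp
  show ?case
  proof (cases "len (u \<otimes> ?v) < len u + len ?v")
    case True
    then obtain z u' where z: "z \<in> C" "u' \<in> carrier W" "\<delta> z p = u" "\<delta> z y = u' \<otimes> ?v" "len u' < len u"
      using step by blast
    obtain z' where z': "z' \<in> C" "\<delta> z' z = s" "\<delta> z' y = s \<otimes> (u' \<otimes> ?v)"
      using left_exist[of z y s] z step by auto
    have "\<delta> z' p = s \<otimes> u" using left_up[of z p z' s] z z' step by simp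
    moreover have "len (s \<otimes> u') < len (s \<otimes> u)" using len_left_le[of s u'] z step by simp
    ultimately show ?thesis using z z' step v
      by (intro bexI[of _ z'] bexI[of _ "s \<otimes> u'"]) (auto simp: m_assoc)
  next
    case False
    obtain z where z: "z \<in> C" "\<delta> z p = u" "\<delta> z y = u \<otimes> ?v"
      using left_exist_mult[of u p y] step by blast
    have "len (s \<otimes> (u \<otimes> ?v)) < len u + 1 + len ?v"
      using step v by (simp add: m_assoc)
    then have "len (s \<otimes> (u \<otimes> ?v)) < len (u \<otimes> ?v)"
      using False len_left_cases[of s "u \<otimes> ?v"] step v by auto
    then obtain p' where p': "p' \<in> C" "\<delta> p' z = s" "\<delta> p' y = u \<otimes> ?v"
      using stuttering[of s z y] z step by auto
    have "\<delta> p' p = s \<otimes> u" using left_up[of z p p' s] z p' step by simp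
    then show ?thesis using p' step by (intro bexI[of _ p'] bexI[of _ u]) auto
  qed
qed

section \<open>Deletion in words and minimal elements of double cosets\<close>

lemma subseq_set: "subseq us ws \<Longrightarrow> set us \<subseteq> set ws"
  by (induction rule: list_emb.induct) auto

lemma subseq_take_drop: "subseq (take i ws @ drop (Suc i) ws) ws"
proof (induction ws arbitrary: i)
  case (Cons a ws)
  then show ?case by (cases i) auto
qed simp

text \<open>Deletion from the right end: a new first letter either lengthens the product and is
  kept, or shortens it, and exchange then deletes a letter of the subword already chosen.
  \<open>len_left_cases\<close> leaves no third case.\<close>

lemma reduced_subseq:
  assumes "set ws \<subseteq> S"
  obtains us where "subseq us ws" "wprod W us = wprod W ws" "length us = len (wprod W ws)"
proof -
  have "\<exists>us. subseq us ws \<and> wprod W us = wprod W ws \<and> length us = len (wprod W ws)"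
    using assms
  proof (induction ws)
    case Nil
    then show ?case by simp
  next
    case (Cons s ws)
    then obtain us where us: "subseq us ws" "wprod W us = wprod W ws" "length us = len (wprod W ws)"
      by auto
    have s: "s \<in> S" "wprod W ws \<in> carrier W" and usS: "set us \<subseteq> S"
      using Cons us(1) by (auto dest!: subseq_set)
    from len_left_cases[OF s] show ?case
    proof
      assume "len (s \<otimes> wprod W ws) = len (wprod W ws) + 1"
      then show ?thesis using us by (intro exI[of _ "s # us"]) auto
    next
      assume l: "len (s \<otimes> wprod W ws) + 1 = len (wprod W ws)"
      obtain i where i: "i < length us" "s \<otimes> wprod W us = wprod W (take i us @ drop (Suc i) us)"
        by (rule exchange[of us s]) (use us usS s l in auto)
      have "subseq (take i us @ drop (Suc i) us) (s # ws)"
        by (intro list_emb_Cons subseq_order.order_trans[OF subseq_take_drop us(1)])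
      moreover have "length (take i us @ drop (Suc i) us) = len (wprod W (s # ws))"
        using i l us by auto
      ultimately show ?thesis using i us by (intro exI[of _ "take i us @ drop (Suc i) us"]) auto
    qed
  qed
  then show ?thesis using that by blast
qed

definition double_coset :: "'w set \<Rightarrow> 'w \<Rightarrow> 'w set" where
  "double_coset J v = {a \<otimes> v \<otimes> b | a b. a \<in> parabolic W J \<and> b \<in> parabolic W J}"

text \<open>Reduce the word \<open>as @ ws @ bs\<close> to a subword. What survives of the middle
  \<open>ws\<close> still represents an element of the double coset, so by minimality no letter of a
  reduced word of \<open>w\<close> is lost. Being a subword remembers from which side each remaining
  letter came.\<close>

lemma double_coset_reduced:
  assumes J: "J \<subseteq> S" and w: "w \<in> carrier W" "\<And>v. v \<in> double_coset J w \<Longrightarrow> len w \<le> len v"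
    and ab: "set as \<subseteq> J" "set bs \<subseteq> J" "z = wprod W as \<otimes> w \<otimes> wprod W bs"
  obtains as' bs' where "subseq as' as" "subseq bs' bs" "z = wprod W as' \<otimes> w \<otimes> wprod W bs'"
    "len z = length as' + len w + length bs'"
proof -
  obtain ws where ws: "set ws \<subseteq> S" "wprod W ws = w" "length ws = len w"
    using reduced_word[OF w(1)] .
  have abS: "set as \<subseteq> S" "set bs \<subseteq> S" using ab J by auto
  have z': "wprod W (as @ ws @ bs) = z"
    using ab ws abS w(1) by (simp add: wprod_append m_assoc)
  obtain us where us: "subseq us (as @ ws @ bs)" "wprod W us = z" "length us = len z"
    by (rule reduced_subseq[of "as @ ws @ bs"]) (use z' abS ws in auto)
  obtain as' vs' where 1: "us = as' @ vs'" "subseq as' as" "subseq vs' (ws @ bs)"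
    using subseq_appendE[OF us(1)] by blast
  obtain ws' bs' where 2: "vs' = ws' @ bs'" "subseq ws' ws" "subseq bs' bs"
    using subseq_appendE[OF 1(3)] by blast
  have sub: "set as' \<subseteq> J" "set bs' \<subseteq> J" "set ws' \<subseteq> S"
    using 1 2 ab ws by (auto dest!: subseq_set)
  have S: "set as' \<subseteq> S" "set bs' \<subseteq> S" "set as \<subseteq> S" "set bs \<subseteq> S" using sub ab J by auto
  have zw': "z = wprod W as' \<otimes> wprod W ws' \<otimes> wprod W bs'"
    using us(2) 1 2 sub S by (simp add: wprod_append m_assoc)
  note P = parabolic_subgroup[OF J]
  have par: "wprod W vs \<in> parabolic W J" if "set vs \<subseteq> J" for vs
    using that parabolic_word[OF J] by blast
  have "wprod W ws' = inv (wprod W as') \<otimes> z \<otimes> inv (wprod W bs')"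
    using zw' sub S by (simp add: m_assoc inv_solve_left)
  also have "\<dots> = (inv (wprod W as') \<otimes> wprod W as) \<otimes> w \<otimes> (wprod W bs \<otimes> inv (wprod W bs'))"
    using ab sub S w by (simp add: m_assoc)
  finally have "wprod W ws' \<in> double_coset J w"
    unfolding double_coset_def
    by (intro CollectI exI[of _ "inv (wprod W as') \<otimes> wprod W as"]
        exI[of _ "wprod W bs \<otimes> inv (wprod W bs')"] conjI refl subgroup.m_closed[OF P]
        subgroup.m_inv_closed[OF P] par ab sub)
  then have "length ws \<le> length ws'"
    using w(2) len_le[OF sub(3)] ws by fastforce
  then have "ws' = ws" using 2(2) by (metis subseq_same_length list_emb_length order_antisym)
  then show ?thesis
    using that[of as' bs'] sub zw' ws us 1 2 by auto
qed

lemma double_coset_self: "J \<subseteq> S \<Longrightarrow> v \<in> carrier W \<Longrightarrow> v \<in> double_coset J v"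
  unfolding double_coset_def using subgroup.one_closed[OF parabolic_subgroup]
  by (intro CollectI exI[of _ \<one>]) auto

lemma double_coset_carrier: "J \<subseteq> S \<Longrightarrow> v \<in> carrier W \<Longrightarrow> double_coset J v \<subseteq> carrier W"
  unfolding double_coset_def using subgroup.mem_carrier[OF parabolic_subgroup] by auto

lemma double_coset_mult:
  assumes J: "J \<subseteq> S" and v: "v \<in> carrier W"
    and "z \<in> double_coset J v" "a \<in> parabolic W J" "b \<in> parabolic W J"
  shows "a \<otimes> z \<otimes> b \<in> double_coset J v"
proof -
  note P = parabolic_subgroup[OF J]
  obtain c d where cd: "c \<in> parabolic W J" "d \<in> parabolic W J" "z = c \<otimes> v \<otimes> d"
    using assms unfolding double_coset_def by blast
  have "a \<otimes> z \<otimes> b = (a \<otimes> c) \<otimes> v \<otimes> (d \<otimes> b)"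
    using cd assms subgroup.mem_carrier[OF P] v by (simp add: m_assoc)
  then show ?thesis unfolding double_coset_def
    using cd assms subgroup.m_closed[OF P] by blast
qed

lemma double_coset_eq:
  assumes J: "J \<subseteq> S" and v: "v \<in> carrier W" and z: "z \<in> double_coset J v"
  shows "double_coset J z = double_coset J v"
proof
  note P = parabolic_subgroup[OF J]
  show "double_coset J z \<subseteq> double_coset J v"
    using double_coset_mult[OF J v z] by (auto simp: double_coset_def[of _ z])
  obtain c d where cd: "c \<in> parabolic W J" "d \<in> parabolic W J" "z = c \<otimes> v \<otimes> d"
    using z unfolding double_coset_def by blast
  have zc: "z \<in> carrier W" using double_coset_carrier[OF J v] z by blast
  have "v = inv c \<otimes> z \<otimes> inv d"
    using cd subgroup.mem_carrier[OF P] v by (simp add: m_assoc inv_solve_left)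
  then have "v \<in> double_coset J z"
    unfolding double_coset_def using cd subgroup.m_inv_closed[OF P] by blast
  then show "double_coset J v \<subseteq> double_coset J z"
    using double_coset_mult[OF J zc] by (auto simp: double_coset_def[of _ v])
qed

section \<open>Residues and the Weyl distance between them\<close>

lemma residue_self: "J \<subseteq> S \<Longrightarrow> x \<in> C \<Longrightarrow> x \<in> residue W C \<delta> J x"
  by (simp add: residue_def subgroup.one_closed[OF parabolic_subgroup])

lemma residue_subset: "residue W C \<delta> J x \<subseteq> C"
  by (auto simp: residue_def)

lemma residue_eq:
  assumes J: "J \<subseteq> S" and "x \<in> C" "y \<in> residue W C \<delta> J x"
  shows "residue W C \<delta> J y = residue W C \<delta> J x"
proof -
  note P = parabolic_subgroup[OF J]
  have y: "y \<in> C" "\<delta> x y \<in> parabolic W J" "\<delta> y x \<in> parabolic W J"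
    using assms dist_inv[of x y] subgroup.m_inv_closed[OF P] by (auto simp: residue_def)
  have "\<delta> b z \<in> parabolic W J" if "a \<in> C" "b \<in> C" "z \<in> C" "\<delta> b a \<in> parabolic W J" "\<delta> a z \<in> parabolic W J" for a b z
    using parabolic_left[OF J that(4) that(2,1,3)] that(5) subgroup.m_closed[OF P] by auto
  then have "\<delta> y z \<in> parabolic W J \<longleftrightarrow> \<delta> x z \<in> parabolic W J" if "z \<in> C" for z
    using that y assms(2) by blast
  then show ?thesis unfolding residue_def by blast
qed

text \<open>Moving inside a residue multiplies by an element of \<open>parabolic W J\<close> on that
  side, so distances stay in the double coset. All of it is attained because
  \<open>left_exist_mult\<close> can be applied at one end and then, after inversion, at the
  other.\<close>

lemma residue_dist_set:
  assumes J: "J \<subseteq> S" and "x \<in> C" "y \<in> C"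
  shows "{\<delta> p q | p q. p \<in> residue W C \<delta> J x \<and> q \<in> residue W C \<delta> J y} = double_coset J (\<delta> x y)"
proof (intro equalityI subsetI)
  note P = parabolic_subgroup[OF J]
  fix v assume "v \<in> {\<delta> p q | p q. p \<in> residue W C \<delta> J x \<and> q \<in> residue W C \<delta> J y}"
  then obtain p q where v: "v = \<delta> p q" "p \<in> C" "q \<in> C" "\<delta> x p \<in> parabolic W J" "\<delta> y q \<in> parabolic W J"
    by (auto simp: residue_def)
  have "\<delta> p x \<in> parabolic W J"
    using dist_inv[of x p] v assms subgroup.m_inv_closed[OF P] by auto
  then obtain a where a: "a \<in> parabolic W J" "\<delta> p q = a \<otimes> \<delta> x q"
    using parabolic_left[OF J _ v(2) assms(2) v(3)] by blast
  obtain b where b: "b \<in> parabolic W J" "\<delta> x q = \<delta> x y \<otimes> b"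
    using parabolic_right[OF J assms(3) v(3) assms(2) v(5)] by blast
  show "v \<in> double_coset J (\<delta> x y)"
    unfolding double_coset_def using a b v assms subgroup.mem_carrier[OF P]
    by (intro CollectI exI[of _ a] exI[of _ b]) (simp add: m_assoc)
next
  note P = parabolic_subgroup[OF J]
  fix v assume "v \<in> double_coset J (\<delta> x y)"
  then obtain a b where ab: "a \<in> parabolic W J" "b \<in> parabolic W J" "v = a \<otimes> \<delta> x y \<otimes> b"
    unfolding double_coset_def by blast
  have c: "a \<in> carrier W" "b \<in> carrier W" using ab subgroup.mem_carrier[OF P] by auto
  obtain p where p: "p \<in> C" "\<delta> p x = a" "\<delta> p y = a \<otimes> \<delta> x y"
    using left_exist_mult[of a x y] c assms by blast
  obtain q where q: "q \<in> C" "\<delta> q y = inv b" "\<delta> q p = inv b \<otimes> \<delta> y p"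
    using left_exist_mult[of "inv b" y p] c assms p by blast
  have "\<delta> p q = v"
    using dist_inv[of q p] dist_inv[of y p] dist_inv[of p y] p q assms c ab
    by (simp add: inv_mult_group)
  moreover have "\<delta> x p = inv a" "\<delta> y q = b"
    using dist_inv[of p x] dist_inv[of q y] p q assms c by auto
  ultimately show "v \<in> {\<delta> p q | p q. p \<in> residue W C \<delta> J x \<and> q \<in> residue W C \<delta> J y}"
    using p(1) q(1) ab(1,2) subgroup.m_inv_closed[OF P ab(1)]
    by (intro CollectI exI[of _ p] exI[of _ q]) (simp add: residue_def)
qed

text \<open>The definite description needs a unique minimum: if \<open>v\<close> is also minimal,
  \<open>double_coset_reduced\<close> writes it as the minimum \<open>m\<close> flanked by two words
  whose lengths add to that of \<open>m\<close>, and equality of lengths leaves both words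
  empty.\<close>

lemma simplex_dist_min:
  assumes J: "J \<subseteq> S" and xy: "x \<in> C" "y \<in> C"
  defines "w \<equiv> simplex_dist W S \<delta> (residue W C \<delta> J x) (residue W C \<delta> J y)"
  shows "w \<in> double_coset J (\<delta> x y)" "v \<in> double_coset J (\<delta> x y) \<Longrightarrow> len w \<le> len v"
proof -
  let ?D = "double_coset J (\<delta> x y)"
  define m where "m = arg_min len (\<lambda>v. v \<in> ?D)"
  have self: "\<delta> x y \<in> ?D" using double_coset_self J xy by simp
  have m: "m \<in> ?D" "\<And>v. v \<in> ?D \<Longrightarrow> len m \<le> len v"
    using arg_min_natI[of "\<lambda>v. v \<in> ?D", OF self] arg_min_nat_le[of "\<lambda>v. v \<in> ?D"]
    unfolding m_def by auto
  have mc: "m \<in> carrier W" using double_coset_carrier[OF J] m(1) xy dist_closed by blast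
  have Dm: "double_coset J m = ?D" using double_coset_eq[OF J _ m(1)] xy by simp
  have "v = m" if "v \<in> ?D" "\<And>u. u \<in> ?D \<Longrightarrow> len v \<le> len u" for v
  proof -
    note v = that
    have vm: "v \<in> double_coset J m" using v(1) Dm by simp
    obtain as bs where ab: "set as \<subseteq> J" "set bs \<subseteq> J" "v = wprod W as \<otimes> m \<otimes> wprod W bs"
      using vm unfolding double_coset_def by (auto simp: parabolic_word[OF J])
    obtain as' bs' where "v = wprod W as' \<otimes> m \<otimes> wprod W bs'" "len v = length as' + len m + length bs'"
      by (rule double_coset_reduced[OF J mc _ ab]) (use m(2) Dm in auto)
    moreover have "len v = len m" using m v by (simp add: order_antisym)
    ultimately show ?thesis using mc by simp
  qed
  note unique = this
  have "(THE w. w \<in> ?D \<and> (\<forall>v\<in>?D. len w \<le> len v)) = m"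
  proof (rule the_equality)
    show "m \<in> ?D \<and> (\<forall>v\<in>?D. len m \<le> len v)" using m by blast
    show "v = m" if "v \<in> ?D \<and> (\<forall>u\<in>?D. len v \<le> len u)" for v
      by (rule unique) (use that in blast)+
  qed
  then have "w = m" unfolding w_def simplex_dist_def residue_dist_set[OF J xy] .
  then show "w \<in> ?D" "v \<in> ?D \<Longrightarrow> len w \<le> len v" using m by auto
qed

end

section \<open>Covering by cosets and conjugation indices\<close>

text \<open>An upper bound on an index that carries its own finiteness, unlike \<open>card\<close>.
  Neither set has to contain the other or be a subgroup.\<close>

definition left_covered :: "('a, 'b) monoid_scheme \<Rightarrow> 'a set \<Rightarrow> 'a set \<Rightarrow> nat \<Rightarrow> bool" where
  "left_covered G X V n \<longleftrightarrow> (\<exists>F. finite F \<and> card F \<le> n \<and> F \<subseteq> carrier G \<and>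
     (\<forall>x\<in>X. \<exists>f\<in>F. \<exists>v\<in>V. x = f \<otimes>\<^bsub>G\<^esub> v))"

definition conj_by :: "('a, 'b) monoid_scheme \<Rightarrow> 'a \<Rightarrow> 'a set \<Rightarrow> 'a set" where
  "conj_by G g V = (\<lambda>v. g \<otimes>\<^bsub>G\<^esub> v \<otimes>\<^bsub>G\<^esub> inv\<^bsub>G\<^esub> g) ` V"

context group
begin

lemma left_covered_trans:
  assumes "left_covered G X V m" "left_covered G V U n" "U \<subseteq> carrier G"
  shows "left_covered G X U (m * n)"
proof -
  obtain E where E: "finite E" "card E \<le> m" "E \<subseteq> carrier G" "\<forall>x\<in>X. \<exists>f\<in>E. \<exists>v\<in>V. x = f \<otimes> v"
    using assms(1) unfolding left_covered_def by blast
  obtain F where F: "finite F" "card F \<le> n" "F \<subseteq> carrier G" "\<forall>x\<in>V. \<exists>f\<in>F. \<exists>v\<in>U. x = f \<otimes> v"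
    using assms(2) unfolding left_covered_def by blast
  let ?H = "(\<lambda>(e, f). e \<otimes> f) ` (E \<times> F)"
  have "card ?H \<le> card (E \<times> F)" using E F by (intro card_image_le) auto
  also have "\<dots> \<le> m * n" using E F by (simp add: mult_le_mono)
  finally have "card ?H \<le> m * n" .
  moreover have "\<exists>h\<in>?H. \<exists>u\<in>U. x = h \<otimes> u" if x: "x \<in> X" for x
  proof -
    obtain e v where ev: "e \<in> E" "v \<in> V" "x = e \<otimes> v" using bspec[OF E(4) x] by blast
    obtain f u where "f \<in> F" "u \<in> U" "v = f \<otimes> u" using bspec[OF F(4) ev(2)] by blast
    moreover have "e \<in> carrier G" "f \<in> carrier G" "u \<in> carrier G"
      using calculation ev E(3) F(3) assms(3) by auto
    ultimately have "x = (e \<otimes> f) \<otimes> u" "u \<in> U" "e \<otimes> f \<in> ?H"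
      using ev(1,3) by (simp_all add: m_assoc image_iff) blast
    then show ?thesis by blast
  qed
  ultimately show ?thesis unfolding left_covered_def using E F
    by (intro exI[of _ ?H]) auto
qed

lemma left_covered_conj:
  assumes "left_covered G X V n" "V \<subseteq> carrier G" "g \<in> carrier G"
  shows "left_covered G (conj_by G g X) (conj_by G g V) n"
proof -
  obtain F where F: "finite F" "card F \<le> n" "F \<subseteq> carrier G" "\<forall>x\<in>X. \<exists>f\<in>F. \<exists>v\<in>V. x = f \<otimes> v"
    using assms(1) unfolding left_covered_def by blast
  let ?H = "conj_by G g F"
  have "card ?H \<le> n" using F(1,2) card_image_le unfolding conj_by_def by (metis le_trans)
  moreover have "\<exists>h\<in>?H. \<exists>u\<in>conj_by G g V. x = h \<otimes> u" if x: "x \<in> conj_by G g X" for x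
  proof -
    obtain y where "y \<in> X" "x = g \<otimes> y \<otimes> inv g" using x by (auto simp: conj_by_def)
    moreover obtain f v where fv: "f \<in> F" "v \<in> V" "y = f \<otimes> v"
      using bspec[OF F(4) \<open>y \<in> X\<close>] by blast
    ultimately have "x = (g \<otimes> f \<otimes> inv g) \<otimes> (g \<otimes> v \<otimes> inv g)"
      using F(3) assms by (simp add: m_assoc subset_eq inv_solve_left)
    then show ?thesis using fv by (auto simp: conj_by_def)
  qed
  ultimately show ?thesis unfolding left_covered_def using F assms
    by (intro exI[of _ ?H]) (auto simp: conj_by_def)
qed

lemma conj_by_mult:
  assumes "V \<subseteq> carrier G" "g \<in> carrier G" "h \<in> carrier G"
  shows "conj_by G (g \<otimes> h) V = conj_by G g (conj_by G h V)"
proof -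
  have "(g \<otimes> h) \<otimes> v \<otimes> inv (g \<otimes> h) = g \<otimes> (h \<otimes> v \<otimes> inv h) \<otimes> inv g" if "v \<in> V" for v
    using that assms by (simp add: m_assoc inv_mult_group subset_eq)
  then show ?thesis unfolding conj_by_def by (simp add: image_image)
qed

lemma conj_by_carrier: "V \<subseteq> carrier G \<Longrightarrow> g \<in> carrier G \<Longrightarrow> conj_by G g V \<subseteq> carrier G"
  by (auto simp: conj_by_def)

lemma subgroup_conj_by:
  assumes "subgroup V G" "g \<in> carrier G"
  shows "subgroup (conj_by G g V) G"
proof (rule subgroupI)
  note V = subgroup.mem_carrier[OF assms(1)]
  show "conj_by G g V \<subseteq> carrier G" using conj_by_carrier subgroup.subset assms by blast
  show "conj_by G g V \<noteq> {}" using subgroup.one_closed[OF assms(1)] by (auto simp: conj_by_def)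
  fix a assume "a \<in> conj_by G g V"
  then obtain v where v: "v \<in> V" "a = g \<otimes> v \<otimes> inv g" by (auto simp: conj_by_def)
  then have "inv a = g \<otimes> inv v \<otimes> inv g" using V assms by (simp add: inv_mult_group m_assoc)
  then show "inv a \<in> conj_by G g V"
    using v subgroup.m_inv_closed[OF assms(1)] by (auto simp: conj_by_def)
  fix b assume "b \<in> conj_by G g V"
  then obtain u where u: "u \<in> V" "b = g \<otimes> u \<otimes> inv g" by (auto simp: conj_by_def)
  have "inv g \<otimes> (g \<otimes> (u \<otimes> inv g)) = u \<otimes> inv g" using V u assms by (simp flip: m_assoc)
  then have "a \<otimes> b = g \<otimes> (v \<otimes> u) \<otimes> inv g" using u v V assms by (simp add: m_assoc)
  then show "a \<otimes> b \<in> conj_by G g V"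
    using u v subgroup.m_closed[OF assms(1)] by (auto simp: conj_by_def)
qed

text \<open>Submultiplicativity: conjugating the cover for \<open>k\<close> by \<open>g\<close>
  gives translates of \<open>g V g^-1\<close>, each of which is covered by \<open>n\<close>
  translates of \<open>V\<close>.\<close>

lemma left_covered_conj_pow:
  assumes "left_covered G (conj_by G g V) V n" "subgroup V G" "g \<in> carrier G"
  shows "left_covered G (conj_by G (g [^] k) V) V (n ^ k)"
proof (induction k)
  case 0
  have "conj_by G (g [^] (0::nat)) V = V"
    using subgroup.subset[OF assms(2)] by (auto simp: conj_by_def image_iff subset_eq)
  then show ?case unfolding left_covered_def
    using subgroup.subset[OF assms(2)] by (intro exI[of _ "{\<one>}"]) (auto intro!: bexI)
next
  case (Suc k)
  note V = subgroup.subset[OF assms(2)]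
  have "g [^] Suc k = g \<otimes> g [^] k" using assms(3) nat_pow_Suc2 by blast
  then have eq: "conj_by G (g [^] Suc k) V = conj_by G g (conj_by G (g [^] k) V)"
    using conj_by_mult[OF V assms(3), of "g [^] k"] assms(3) by simp
  have "left_covered G (conj_by G g (conj_by G (g [^] k) V)) (conj_by G g V) (n ^ k)"
    by (rule left_covered_conj[OF Suc V assms(3)])
  then have "left_covered G (conj_by G g (conj_by G (g [^] k) V)) V (n ^ k * n)"
    using left_covered_trans assms(1) V by blast
  then show ?case unfolding eq by (simp add: mult.commute)
qed

text \<open>Pass from \<open>h U h^-1\<close> to \<open>h V h^-1\<close>, then to \<open>V\<close>,
  then to \<open>U\<close>. The price \<open>p * r\<close> does not depend on \<open>h\<close>, so
  it disappears when roots are taken.\<close>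

lemma left_covered_conj_compare:
  assumes "left_covered G U V p" "left_covered G V U r" "left_covered G (conj_by G h V) V n"
    and "U \<subseteq> carrier G" "V \<subseteq> carrier G" "h \<in> carrier G"
  shows "left_covered G (conj_by G h U) U (p * n * r)"
proof -
  have "left_covered G (conj_by G h U) (conj_by G h V) p"
    using left_covered_conj assms by blast
  then have "left_covered G (conj_by G h U) V (p * n)"
    using left_covered_trans assms by blast
  then show ?thesis using left_covered_trans assms by blast
qed

text \<open>Elements of \<open>P\<close> covered by the same translate of \<open>V\<close> differ by
  an element of \<open>P \<inter> V\<close>; so there are no more cosets than translates, although
  the translating elements may lie outside \<open>P\<close>.\<close>

lemma coset_card_le:
  assumes "left_covered G P V n" "subgroup P G" "subgroup V G"
  shows "finite ((\<lambda>h. (\<lambda>k. h \<otimes> k) ` (P \<inter> V)) ` P)"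
    and "card ((\<lambda>h. (\<lambda>k. h \<otimes> k) ` (P \<inter> V)) ` P) \<le> n"
proof -
  let ?Q = "(\<lambda>h. (\<lambda>k. h \<otimes> k) ` (P \<inter> V)) ` P"
  obtain F where F: "finite F" "card F \<le> n" "F \<subseteq> carrier G" "\<forall>x\<in>P. \<exists>f\<in>F. \<exists>v\<in>V. x = f \<otimes> v"
    using assms(1) unfolding left_covered_def by blast
  have PV: "subgroup (P \<inter> V) G" using subgroups_Inter_pair assms by blast
  have "\<forall>x\<in>P. \<exists>f. f \<in> F \<and> (\<exists>v\<in>V. x = f \<otimes> v)" using F(4) by blast
  then obtain c where c: "\<forall>x\<in>P. c x \<in> F \<and> (\<exists>v\<in>V. x = c x \<otimes> v)"
    by (rule bchoice[THEN exE])
  have coset: "(\<lambda>k. h \<otimes> k) ` (P \<inter> V) = (\<lambda>k. h' \<otimes> k) ` (P \<inter> V)"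
    if h: "h \<in> P" "h' \<in> P" "c h = c h'" for h h'
  proof -
    obtain v where v: "c h \<in> F" "v \<in> V" "h = c h \<otimes> v"
      using bspec[OF c h(1)] by blast
    obtain v' where v': "v' \<in> V" "h' = c h \<otimes> v'"
      using bspec[OF c h(2)] h(3) by auto
    have cl: "c h \<in> carrier G" "v \<in> carrier G" "v' \<in> carrier G" "h \<in> carrier G" "h' \<in> carrier G"
      using subsetD[OF F(3) v(1)] subgroup.mem_carrier[OF assms(2)] subgroup.mem_carrier[OF assms(3)]
        v(2) v'(1) that(1,2) by simp_all
    have "v \<otimes> (inv v \<otimes> v') = v'" using cl by (simp flip: m_assoc)
    then have "h \<otimes> (inv v \<otimes> v') = h'"
      using v(3) v'(2) cl by (metis inv_closed m_assoc m_closed)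
    then have "inv h \<otimes> h' = inv v \<otimes> v'" using cl inv_solve_left' by auto
    then have "inv h \<otimes> h' \<in> V"
      using v(2) v'(1) subgroup.m_closed subgroup.m_inv_closed assms(3) by metis
    moreover have "inv h \<otimes> h' \<in> P"
      using that(1,2) subgroup.m_closed subgroup.m_inv_closed assms(2) by metis
    ultimately have "h' \<in> h <# (P \<inter> V)"
      unfolding l_coset_def using cl by (auto intro!: bexI[of _ "inv h \<otimes> h'"] simp flip: m_assoc)
    then have "h <# (P \<inter> V) = h' <# (P \<inter> V)"
      using l_repr_independence[OF _ cl(4) PV] by blast
    then show ?thesis by (simp add: l_coset_def UNION_singleton_eq_range)
  qed
  let ?r = "\<lambda>f. (\<lambda>k. (SOME h. h \<in> P \<and> c h = f) \<otimes> k) ` (P \<inter> V)"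
  have "?Q \<subseteq> ?r ` F"
  proof
    fix q assume "q \<in> ?Q"
    then obtain h where h: "h \<in> P" "q = (\<lambda>k. h \<otimes> k) ` (P \<inter> V)" by blast
    have "(SOME h'. h' \<in> P \<and> c h' = c h) \<in> P \<and> c (SOME h'. h' \<in> P \<and> c h' = c h) = c h"
      by (rule someI[of _ h]) (use h in auto)
    then have "q = ?r (c h)" using coset[of h] h by metis
    then show "q \<in> ?r ` F" using c h by blast
  qed
  then show "finite ?Q" "card ?Q \<le> n"
    using F(1,2) surj_card_le[of F ?Q ?r] by (auto intro: finite_surj)
qed

text \<open>The converse of \<open>coset_card_le\<close>, with one representative per coset. For an
  infinite family of cosets \<open>card\<close> would be 0 and bound nothing.\<close>

lemma coset_covered:
  assumes "finite ((\<lambda>h. (\<lambda>k. h \<otimes> k) ` (P \<inter> V)) ` P)" "subgroup P G" "subgroup V G"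
  shows "left_covered G P V (card ((\<lambda>h. (\<lambda>k. h \<otimes> k) ` (P \<inter> V)) ` P))"
proof -
  let ?c = "\<lambda>h. (\<lambda>k. h \<otimes> k) ` (P \<inter> V)"
  let ?r = "inv_into P ?c"
  let ?F = "?r ` (?c ` P)"
  have "\<exists>f\<in>?F. \<exists>v\<in>V. x = f \<otimes> v" if "x \<in> P" for x
  proof -
    have "?c (?r (?c x)) = ?c x" using that by (intro f_inv_into_f) auto
    moreover have "x \<in> ?c x"
      using that assms subgroup.one_closed subgroup.mem_carrier
      by (intro image_eqI[of _ _ \<one>]) fastforce+
    ultimately have "x \<in> ?c (?r (?c x))" by simp
    then show ?thesis using that by blast
  qed
  moreover have "?F \<subseteq> carrier G"
    using subgroup.subset[OF assms(2)] by (auto intro!: subsetD[of P] inv_into_into)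
  ultimately show ?thesis unfolding left_covered_def using assms(1) card_image_le[OF assms(1)]
    by (intro exI[of _ ?F]) auto
qed

end

text \<open>The sets \<open>A w\<^sup>n A\<close> have at most \<open>|A|\<^sup>2\<close> elements, and \<open>w A w\<^sup>n A\<close> lies in the next one, so
  their sizes stabilise at some \<open>N\<close>; from there on, left translation by \<open>w\<close> maps each onto the
  next. Hence all conjugates \<open>w\<^sup>-\<^sup>k A w\<^sup>k\<close> lie in one finite set, some positive power of \<open>w\<close>
  centralises \<open>A\<close>, and the maximal size is only \<open>|A|\<close>.\<close>
lemma (in group) normalizes_if_powers_single_double_coset:
  assumes A: "subgroup A G" "finite A" and w: "w \<in> carrier G"
    and pow: "\<And>n u. u \<in> A \<Longrightarrow> \<exists>a\<in>A. \<exists>b\<in>A. w \<otimes> u \<otimes> w [^] (n::nat) = a \<otimes> w [^] Suc n \<otimes> b"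
    and a: "a \<in> A"
  shows "inv w \<otimes> a \<otimes> w \<in> A"
proof -
  define D where "D n = (\<lambda>(a, b). a \<otimes> w [^] (n::nat) \<otimes> b) ` (A \<times> A)" for n
  have cl [simp]: "a \<in> carrier G" if "a \<in> A" for a
    by (rule subgroup.mem_carrier[OF A(1) that])
  have mA [simp]: "a \<otimes> b \<in> A" if "a \<in> A" "b \<in> A" for a b
    by (rule subgroup.m_closed[OF A(1) that])
  have oA [simp]: "\<one> \<in> A" by (rule subgroup.one_closed[OF A(1)])
  have fin: "finite (D n)" for n unfolding D_def using A by simp
  have DI: "a \<otimes> w [^] n \<otimes> b \<in> D n" if "a \<in> A" "b \<in> A" for a b n
    unfolding D_def using that by (auto intro!: image_eqI[of _ _ "(a, b)"])
  have wD: "(\<lambda>z. w \<otimes> z) ` D n \<subseteq> D (Suc n)" for n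
  proof
    fix z assume "z \<in> (\<lambda>z. w \<otimes> z) ` D n"
    then obtain a b where ab: "a \<in> A" "b \<in> A" "z = w \<otimes> (a \<otimes> w [^] n \<otimes> b)"
      unfolding D_def by auto
    obtain c d where cd: "c \<in> A" "d \<in> A" "w \<otimes> a \<otimes> w [^] n = c \<otimes> w [^] Suc n \<otimes> d"
      using pow[OF ab(1)] by blast
    have "z = (w \<otimes> a \<otimes> w [^] n) \<otimes> b" using ab w by (simp add: m_assoc)
    also have "\<dots> = c \<otimes> w [^] Suc n \<otimes> (d \<otimes> b)"
      unfolding cd(3) using ab cd w by (simp add: m_assoc)
    finally show "z \<in> D (Suc n)"
      using DI[OF cd(1) mA[OF cd(2) ab(2)], of "Suc n"] by (simp only:)
  qed
  have inj: "inj_on (\<lambda>z. v \<otimes> z) X" if "v \<in> carrier G" "X \<subseteq> carrier G" for v X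
    using that by (auto simp: inj_on_def subset_eq)
  have Dc: "D n \<subseteq> carrier G" for n unfolding D_def using w by auto
  have "\<exists>N. True \<and> (\<forall>n. True \<longrightarrow> card (D n) \<le> card (D N))"
  proof (rule ex_has_greatest_nat)
    show "\<forall>n. True \<longrightarrow> card (D n) < Suc (card (A \<times> A))"
      unfolding D_def less_Suc_eq_le by (intro allI impI card_image_le finite_cartesian_product A(2))
  qed simp
  then obtain N where N: "\<And>n. card (D n) \<le> card (D N)" by blast
  have card_mono: "card (D n) \<le> card (D (Suc n))" for n
    using card_mono[OF fin wD, of n] card_image[OF inj[OF w Dc], of n] by simp
  have ge: "card (D (N + k)) = card (D N)" for k
  proof (induction k)
    case (Suc k)
    then show ?case using card_mono[of "N + k"] N[of "N + Suc k"] by simp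
  qed simp
  have step: "D (Suc (N + k)) = (\<lambda>z. w \<otimes> z) ` D (N + k)" for k
    using card_subset_eq[OF fin wD, of "N + k"] card_image[OF inj[OF w Dc], of "N + k"]
      ge[of k] ge[of "Suc k"] by simp
  have Dk: "D (N + k) = (\<lambda>z. w [^] k \<otimes> z) ` D N" for k
  proof (induction k)
    case 0
    then show ?case using Dc[of N] by (auto simp: image_iff subset_eq)
  next
    case (Suc k)
    have "w \<otimes> (w [^] k \<otimes> z) = w [^] Suc k \<otimes> z" if "z \<in> D N" for z
      using that Dc[of N] w nat_pow_Suc2[OF w, of k] by (simp add: subset_eq flip: m_assoc)
    then show ?case using Suc step[of k] by (simp add: image_image)
  qed
  \<comment> \<open>For \<open>a\<close> in \<open>A\<close>, \<open>a w^(N+k)\<close> lies in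
    \<open>D (N+k) = w^k D N\<close>; cancelling \<open>w^k\<close> on the left and
    \<open>w^N\<close> on the right puts \<open>w^-k a w^k\<close> into \<open>E\<close>, which does
    not involve \<open>k\<close>.\<close>
  define E where "E = (\<lambda>z. z \<otimes> inv (w [^] N)) ` D N"
  have finE: "finite E" unfolding E_def using fin by simp
  \<comment> \<open>Conjugations by powers of \<open>w\<close>, seen as elements of the finite
    function space from \<open>A\<close> to \<open>E\<close>: two exponents give the same function,
    and their difference \<open>m\<close> is the exponent of a power centralising
    \<open>A\<close>.\<close>
  define f where "f k = (\<lambda>a\<in>A. inv (w [^] (k::nat)) \<otimes> a \<otimes> w [^] k)" for k
  have "f k \<in> A \<rightarrow>\<^sub>E E" for k
  proof -
    have "inv (w [^] k) \<otimes> a \<otimes> w [^] k \<in> E" if a: "a \<in> A" for a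
    proof -
      have "a \<otimes> w [^] (N + k) \<otimes> \<one> \<in> D (N + k)" using DI a oA by blast
      then have "a \<otimes> w [^] (N + k) \<in> D (N + k)" using a w by simp
      then obtain z where z: "z \<in> D N" "a \<otimes> w [^] (N + k) = w [^] k \<otimes> z"
        using Dk by auto
      have zc: "z \<in> carrier G" using z Dc by blast
      have "w [^] (N + k) = w [^] k \<otimes> w [^] N"
        using w nat_pow_mult[of w k N] by (simp add: add.commute)
      then have "z = inv (w [^] k) \<otimes> (a \<otimes> (w [^] k \<otimes> w [^] N))"
        using z zc w a by (simp add: inv_solve_left)
      then have "z \<otimes> inv (w [^] N) = inv (w [^] k) \<otimes> a \<otimes> w [^] k"
        using w a by (simp add: m_assoc)
      then show ?thesis unfolding E_def using z by (metis image_eqI)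
    qed
    then show ?thesis unfolding f_def by auto
  qed
  then have "finite (range f)"
    using finite_PiE[OF A(2), of "\<lambda>_. E"] finE by (meson finite_subset image_subsetI)
  then have "\<not> inj f" using finite_imageD infinite_UNIV_nat by blast
  then obtain k l where kl: "k < l" "f k = f l"
    by (auto simp: inj_def) (metis linorder_neqE_nat)
  define m where "m = l - k"
  have m: "0 < m" "l = m + k" using kl by (auto simp: m_def)
  have comm: "w [^] m \<otimes> a = a \<otimes> w [^] m" if a: "a \<in> A" for a
  proof -
    define p q where "p = w [^] k" and "q = w [^] m"
    have pq: "p \<in> carrier G" "q \<in> carrier G" "w [^] l = q \<otimes> p"
      using w m nat_pow_mult[of w m k] by (auto simp: p_def q_def)
    have "inv p \<otimes> a \<otimes> p = inv (q \<otimes> p) \<otimes> a \<otimes> (q \<otimes> p)"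
      using fun_cong[OF kl(2), of a] a pq unfolding f_def by (simp add: p_def)
    then have "inv p \<otimes> (a \<otimes> p) = inv p \<otimes> ((inv q \<otimes> a \<otimes> q) \<otimes> p)"
      using pq a by (simp add: inv_mult_group m_assoc)
    then have "a \<otimes> p = (inv q \<otimes> a \<otimes> q) \<otimes> p" using pq a by simp
    then have "a = inv q \<otimes> a \<otimes> q" using pq a by simp
    then have "a = inv q \<otimes> (a \<otimes> q)" using pq a by (simp add: m_assoc)
    then have "a \<otimes> q = q \<otimes> a" using pq a inv_solve_left[of a q "a \<otimes> q"] by simp
    then show ?thesis by (simp add: q_def)
  qed
  \<comment> \<open>A multiple of \<open>m\<close>, so that \<open>w^M\<close> centralises
    \<open>A\<close> and \<open>D M\<close> is just \<open>w^M A\<close>; and at least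
    \<open>N\<close>, so that \<open>D M\<close> has the maximal size. Hence no \<open>D n\<close>
    has more than \<open>card A\<close> elements.\<close>
  define M where "M = m * Suc N"
  have commM: "a \<otimes> (w [^] m) [^] j = (w [^] m) [^] j \<otimes> a" if a: "a \<in> A" for a and j :: nat
  proof (induction j)
    case (Suc j)
    have "a \<otimes> (w [^] m) [^] Suc j = (a \<otimes> (w [^] m) [^] j) \<otimes> w [^] m"
      using a w by (simp add: m_assoc)
    also have "\<dots> = (w [^] m) [^] j \<otimes> (a \<otimes> w [^] m)" using Suc a w by (simp add: m_assoc)
    also have "\<dots> = (w [^] m) [^] Suc j \<otimes> a" using comm[OF a] a w by (simp add: m_assoc)
    finally show ?case .
  qed (use a in simp)
  have "D M \<subseteq> (\<lambda>z. w [^] M \<otimes> z) ` A"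
  proof
    fix z assume "z \<in> D M"
    then obtain a b where ab: "a \<in> A" "b \<in> A" "z = a \<otimes> w [^] M \<otimes> b"
      unfolding D_def by auto
    have "a \<otimes> w [^] M = w [^] M \<otimes> a"
      using commM[OF ab(1), of "Suc N"] w unfolding M_def by (simp only: nat_pow_pow)
    then have "z = w [^] M \<otimes> (a \<otimes> b)" using ab w by (simp add: m_assoc)
    then show "z \<in> (\<lambda>z. w [^] M \<otimes> z) ` A" using ab by simp
  qed
  then have "card (D M) \<le> card A" using A(2) by (rule surj_card_le[rotated])
  moreover have "N \<le> M" unfolding M_def using m(1) by (cases m) auto
  then have "card (D M) = card (D N)" using ge[of "M - N"] by simp
  ultimately have D1: "card (D 1) \<le> card A" using N[of 1] by simp
  have sub: "(\<lambda>z. w \<otimes> z) ` A \<subseteq> D 1"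
  proof
    fix z assume "z \<in> (\<lambda>z. w \<otimes> z) ` A"
    then obtain b where "b \<in> A" "z = w \<otimes> b" by blast
    then show "z \<in> D 1" using DI[of \<one> b 1] w by simp
  qed
  \<comment> \<open>By counting, \<open>w A\<close> fills all of \<open>A w A\<close>, so
    \<open>a w\<close> has the form \<open>w b\<close>.\<close>
  have "card ((\<lambda>z. w \<otimes> z) ` A) = card A"
    by (rule card_image[OF inj[OF w]]) auto
  then have "(\<lambda>z. w \<otimes> z) ` A = D 1"
    using card_seteq[OF fin sub] D1 by simp
  moreover have "a \<otimes> w \<in> D 1" using DI[of a \<one> 1] a w by simp
  ultimately obtain b where b: "b \<in> A" "a \<otimes> w = w \<otimes> b" by blast
  then have "inv w \<otimes> (a \<otimes> w) = b" using w a inv_solve_left'[of b w "a \<otimes> w"] by simp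
  then have "inv w \<otimes> a \<otimes> w = b" using w a by (simp add: m_assoc)
  then show ?thesis using b by simp
qed

section \<open>Weyl-transitive groups and their topology\<close>

definition perm_group :: "'c set \<Rightarrow> ('c \<Rightarrow> 'c) set \<Rightarrow> ('c \<Rightarrow> 'c) monoid" where
  "perm_group C G = \<lparr>carrier = G, mult = pcomp C, one = pid C\<rparr>"

locale weyl_transitive_group = thick_building W S C \<delta>
  for W :: "('w, 'b) monoid_scheme" (structure) and S :: "'w set"
    and C :: "'c set" and \<delta> :: "'c \<Rightarrow> 'c \<Rightarrow> 'w" +
  fixes G :: "('c \<Rightarrow> 'c) set"
  assumes locally_finite: "locally_finite S C \<delta>"
    and perm_subgroup_G: "perm_subgroup C G (tp_aut C \<delta>)"
    and closed_G: "closedin (subtopology (aut_topology C) (tp_aut C \<delta>)) G"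
    and weyl_transitive_G: "weyl_transitive C \<delta> G"
begin

abbreviation \<Gamma> :: "('c \<Rightarrow> 'c) monoid" where "\<Gamma> \<equiv> perm_group C G"

lemma carrier_\<Gamma> [simp]: "carrier \<Gamma> = G"
  by (simp add: perm_group_def)

lemma G_tp_aut: "f \<in> G \<Longrightarrow> f \<in> tp_aut C \<delta>"
  using perm_subgroup_G by (auto simp: perm_subgroup_def)

lemma G_bij: "f \<in> G \<Longrightarrow> bij_betw f C C"
  and G_extensional: "f \<in> G \<Longrightarrow> f \<in> extensional C"
  and G_dist [simp]: "f \<in> G \<Longrightarrow> x \<in> C \<Longrightarrow> y \<in> C \<Longrightarrow> \<delta> (f x) (f y) = \<delta> x y"
  using G_tp_aut by (auto simp: tp_aut_def)

lemma G_closed [simp]: "f \<in> G \<Longrightarrow> x \<in> C \<Longrightarrow> f x \<in> C"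
  using G_bij by (auto simp: bij_betw_def)

lemma G_PiE: "f \<in> G \<Longrightarrow> f \<in> C \<rightarrow>\<^sub>E C"
  by (simp add: PiE_iff G_extensional)

lemma G_eqI: "\<lbrakk>f \<in> G; h \<in> G; \<And>x. x \<in> C \<Longrightarrow> f x = h x\<rbrakk> \<Longrightarrow> f = h"
  using extensionalityI[of f C h] G_extensional by blast

lemma mult_\<Gamma>_apply [simp]: "x \<in> C \<Longrightarrow> (f \<otimes>\<^bsub>\<Gamma>\<^esub> h) x = f (h x)"
  by (simp add: perm_group_def pcomp_def)

lemma one_\<Gamma>_apply [simp]: "x \<in> C \<Longrightarrow> \<one>\<^bsub>\<Gamma>\<^esub> x = x"
  by (simp add: perm_group_def pid_def)

lemma mult_\<Gamma>_closed: "f \<in> G \<Longrightarrow> h \<in> G \<Longrightarrow> f \<otimes>\<^bsub>\<Gamma>\<^esub> h \<in> G"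
  and one_\<Gamma>_closed: "\<one>\<^bsub>\<Gamma>\<^esub> \<in> G"
  and pinv_closed: "f \<in> G \<Longrightarrow> pinv C f \<in> G"
  using perm_subgroup_G by (auto simp: perm_subgroup_def perm_group_def)

lemma pinv_left: "f \<in> G \<Longrightarrow> x \<in> C \<Longrightarrow> pinv C f (f x) = x"
  using G_bij[of f] by (simp add: pinv_def bij_betw_inv_into_left)

sublocale aut: group \<Gamma>
proof (rule groupI)
  fix f assume f: "f \<in> carrier \<Gamma>"
  have "pinv C f \<otimes>\<^bsub>\<Gamma>\<^esub> f = \<one>\<^bsub>\<Gamma>\<^esub>"
    by (rule G_eqI) (use f in \<open>simp_all add: mult_\<Gamma>_closed one_\<Gamma>_closed pinv_closed pinv_left\<close>)
  then show "\<exists>h\<in>carrier \<Gamma>. h \<otimes>\<^bsub>\<Gamma>\<^esub> f = \<one>\<^bsub>\<Gamma>\<^esub>" using f pinv_closed by auto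
next
  fix f h k assume "f \<in> carrier \<Gamma>" "h \<in> carrier \<Gamma>" "k \<in> carrier \<Gamma>"
  then show "(f \<otimes>\<^bsub>\<Gamma>\<^esub> h) \<otimes>\<^bsub>\<Gamma>\<^esub> k = f \<otimes>\<^bsub>\<Gamma>\<^esub> (h \<otimes>\<^bsub>\<Gamma>\<^esub> k)"
    by (intro G_eqI) (simp_all add: mult_\<Gamma>_closed)
next
  fix f assume "f \<in> carrier \<Gamma>"
  then show "\<one>\<^bsub>\<Gamma>\<^esub> \<otimes>\<^bsub>\<Gamma>\<^esub> f = f"
    by (intro G_eqI) (simp_all add: mult_\<Gamma>_closed one_\<Gamma>_closed)
qed (simp_all add: mult_\<Gamma>_closed one_\<Gamma>_closed)

lemma inv_\<Gamma>: "f \<in> G \<Longrightarrow> inv\<^bsub>\<Gamma>\<^esub> f = pinv C f"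
proof (rule aut.inv_equality)
  assume f: "f \<in> G"
  show "pinv C f \<otimes>\<^bsub>\<Gamma>\<^esub> f = \<one>\<^bsub>\<Gamma>\<^esub>"
    by (rule G_eqI) (use f in \<open>simp_all add: mult_\<Gamma>_closed one_\<Gamma>_closed pinv_closed pinv_left\<close>)
qed (simp_all add: pinv_closed)

lemma inv_\<Gamma>_closed [simp]: "f \<in> G \<Longrightarrow> inv\<^bsub>\<Gamma>\<^esub> f \<in> G"
  by (simp add: inv_\<Gamma> pinv_closed)

lemma inv_\<Gamma>_left [simp]: "f \<in> G \<Longrightarrow> x \<in> C \<Longrightarrow> (inv\<^bsub>\<Gamma>\<^esub> f) (f x) = x"
  by (simp add: inv_\<Gamma> pinv_left)

lemma inv_\<Gamma>_right [simp]: "f \<in> G \<Longrightarrow> x \<in> C \<Longrightarrow> f ((inv\<^bsub>\<Gamma>\<^esub> f) x) = x"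
  by (metis aut.inv_inv carrier_\<Gamma> inv_\<Gamma>_closed inv_\<Gamma>_left)

lemma image_mult_\<Gamma>: "A \<subseteq> C \<Longrightarrow> (f \<otimes>\<^bsub>\<Gamma>\<^esub> h) ` A = f ` (h ` A)"
  by (auto simp: image_iff subset_eq)

lemma image_one_\<Gamma>: "A \<subseteq> C \<Longrightarrow> \<one>\<^bsub>\<Gamma>\<^esub> ` A = A"
  by (auto simp: image_iff subset_eq)

lemma image_inv_\<Gamma>: "f \<in> G \<Longrightarrow> A \<subseteq> C \<Longrightarrow> B \<subseteq> C \<Longrightarrow> (inv\<^bsub>\<Gamma>\<^esub> f) ` A = B \<longleftrightarrow> f ` B = A"
  using aut.inv_inv[of f] image_mult_\<Gamma>[of A f "inv\<^bsub>\<Gamma>\<^esub> f"] image_mult_\<Gamma>[of B "inv\<^bsub>\<Gamma>\<^esub> f" f]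
  by (auto simp: image_one_\<Gamma>)

lemma perm_subgroup_iff: "perm_subgroup C H G \<longleftrightarrow> subgroup H \<Gamma>"
proof
  assume H: "perm_subgroup C H G"
  then show "subgroup H \<Gamma>"
    by (intro subgroup.intro)
      (auto simp: perm_subgroup_def perm_group_def subset_eq simp flip: inv_\<Gamma>)
next
  assume H: "subgroup H \<Gamma>"
  have "pinv C f \<in> H" if "f \<in> H" for f
    using subgroup.m_inv_closed[OF H that] subgroup.mem_carrier[OF H that] by (simp add: inv_\<Gamma>)
  then show "perm_subgroup C H G"
    using subgroup.subset[OF H] subgroup.one_closed[OF H] subgroup.m_closed[OF H]
    unfolding perm_subgroup_def by (auto simp: perm_group_def)
qed

lemma conj_index_eq:
  assumes "U \<subseteq> G" "g \<in> G"
  shows "conj_index C g U =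
    card ((\<lambda>h. (\<lambda>k. h \<otimes>\<^bsub>\<Gamma>\<^esub> k) ` (conj_by \<Gamma> g U \<inter> U)) ` conj_by \<Gamma> g U)"
proof -
  have "(\<lambda>u. pcomp C (pcomp C g u) (pinv C g)) ` U = conj_by \<Gamma> g U"
    using inv_\<Gamma>[OF assms(2)] by (simp add: conj_by_def perm_group_def)
  moreover have "pcomp C = (\<lambda>h k. h \<otimes>\<^bsub>\<Gamma>\<^esub> k)" by (simp add: perm_group_def)
  ultimately show ?thesis unfolding conj_index_def Let_def by simp
qed

lemma transitive_on_pairs:
  assumes "x \<in> C" "y \<in> C" "x' \<in> C" "y' \<in> C" "\<delta> x y = \<delta> x' y'"
  obtains h where "h \<in> G" "h x = x'" "h y = y'"
  using weyl_transitive_G assms unfolding weyl_transitive_def by blast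

lemma transitive:
  assumes "x \<in> C" "x' \<in> C"
  obtains h where "h \<in> G" "h x = x'"
  using transitive_on_pairs[of x x x' x'] assms by auto

lemma finite_sphere:
  assumes "v \<in> carrier W" "y \<in> C"
  shows "finite {x \<in> C. \<delta> y x = v}"
  using assms
proof (induction arbitrary: y rule: len_induct)
  case one
  have "{x \<in> C. \<delta> y x = \<one>} \<subseteq> {y}" using dist_eq_one one by blast
  then show ?case using finite_subset by blast
next
  case (step s u)
  have "{x \<in> C. \<delta> y x = s \<otimes> u} \<subseteq> (\<Union>z\<in>{z \<in> C. \<delta> y z = s}. {x \<in> C. \<delta> z x = u})"
  proof
    fix x assume x: "x \<in> {x \<in> C. \<delta> y x = s \<otimes> u}"
    obtain z where "z \<in> C" "\<delta> y z = s" "\<delta> z x = u"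
      by (rule split_dist[of s u y x]) (use x step in auto)
    then show "x \<in> (\<Union>z\<in>{z \<in> C. \<delta> y z = s}. {x \<in> C. \<delta> z x = u})" using x by blast
  qed
  moreover have "finite {z \<in> C. \<delta> y z = s}"
    using locally_finite step unfolding locally_finite_def by blast
  ultimately show ?case using step finite_subset by (metis (no_types, lifting) finite_UN_I mem_Collect_eq)
qed

lemma finite_residue:
  assumes "spherical W S J" "x \<in> C"
  shows "finite (residue W C \<delta> J x)"
proof -
  have J: "J \<subseteq> S" "finite (parabolic W J)" using assms(1) by (auto simp: spherical_def)
  have "residue W C \<delta> J x = (\<Union>v\<in>parabolic W J. {y \<in> C. \<delta> x y = v})"
    by (auto simp: residue_def)
  moreover have "finite {y \<in> C. \<delta> x y = v}" if "v \<in> parabolic W J" for v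
    using finite_sphere subgroup.mem_carrier[OF parabolic_subgroup[OF J(1)] that] assms(2) by blast
  ultimately show ?thesis using J(2) by simp
qed

lemma image_sphere:
  assumes "h \<in> G" "y \<in> C"
  shows "h ` {x \<in> C. P (\<delta> y x)} = {x \<in> C. P (\<delta> (h y) x)}"
proof (intro equalityI subsetI)
  fix x assume x: "x \<in> {x \<in> C. P (\<delta> (h y) x)}"
  have "(inv\<^bsub>\<Gamma>\<^esub> h) x \<in> C" using x assms by simp
  moreover have "\<delta> y ((inv\<^bsub>\<Gamma>\<^esub> h) x) = \<delta> (h y) x"
    using G_dist[OF assms(1,2) calculation] x inv_\<Gamma>_right[OF assms(1), of x] by auto
  ultimately show "x \<in> h ` {x \<in> C. P (\<delta> y x)}"
    using x assms by (intro image_eqI[of _ _ "(inv\<^bsub>\<Gamma>\<^esub> h) x"]) auto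
qed (use assms in auto)

lemma G_inj: "h \<in> G \<Longrightarrow> inj_on h C"
  using G_bij by (simp add: bij_betw_def)

lemma card_sphere_eq:
  assumes "y \<in> C" "z \<in> C"
  shows "card {x \<in> C. \<delta> y x = v} = card {x \<in> C. \<delta> z x = v}"
proof -
  obtain h where h: "h \<in> G" "h y = z" using transitive assms by blast
  have im: "h ` {x \<in> C. \<delta> y x = v} = {x \<in> C. \<delta> z x = v}"
    using image_sphere[OF h(1) assms(1), of "\<lambda>u. u = v"] h(2) by simp
  have "inj_on h {x \<in> C. \<delta> y x = v}" using G_inj[OF h(1)] by (rule inj_on_subset) auto
  from card_image[OF this] show ?thesis unfolding im by simp
qed

lemma image_residue:
  assumes "h \<in> G" "x \<in> C"
  shows "h ` residue W C \<delta> J x = residue W C \<delta> J (h x)"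
  unfolding residue_def by (rule image_sphere[OF assms])

lemma stabilizer_residue:
  assumes J: "J \<subseteq> S" and x: "x \<in> C"
  shows "stabilizer G (residue W C \<delta> J x) = {h \<in> G. h x \<in> residue W C \<delta> J x}"
proof -
  have "h ` residue W C \<delta> J x = residue W C \<delta> J x \<longleftrightarrow> h x \<in> residue W C \<delta> J x" if h: "h \<in> G" for h
    using image_residue[OF h x] residue_eq[OF J x] residue_self[OF J x] by (metis imageI)
  then show ?thesis unfolding stabilizer_def by blast
qed

section \<open>The topology of pointwise convergence on the group\<close>

lemma topspace_aut: "topspace (aut_topology C) = C \<rightarrow>\<^sub>E C"
  by (simp add: aut_topology_def)

lemma open_eval:
  assumes "x \<in> C"
  shows "openin (aut_topology C) {f \<in> C \<rightarrow>\<^sub>E C. f x \<in> A}"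
proof -
  have "continuous_map (aut_topology C) (discrete_topology C) (\<lambda>f. f x)"
    unfolding aut_topology_def by (rule continuous_map_product_projection[OF assms])
  then have "openin (aut_topology C) {f \<in> topspace (aut_topology C). f x \<in> A \<inter> C}"
    by (rule openin_continuous_map_preimage) auto
  moreover have "{f \<in> topspace (aut_topology C). f x \<in> A \<inter> C} = {f \<in> C \<rightarrow>\<^sub>E C. f x \<in> A}"
    using assms by (auto simp: topspace_aut)
  ultimately show ?thesis by simp
qed

lemma closed_eval:
  assumes "x \<in> C"
  shows "closedin (aut_topology C) {f \<in> C \<rightarrow>\<^sub>E C. f x \<in> A}"
proof -
  have "(C \<rightarrow>\<^sub>E C) - {f \<in> C \<rightarrow>\<^sub>E C. f x \<in> A} = {f \<in> C \<rightarrow>\<^sub>E C. f x \<in> - A}" by auto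
  then show ?thesis using open_eval[OF assms, of "- A"] by (simp add: closedin_def topspace_aut)
qed

text \<open>Surjectivity is not a pointwise condition, but it is automatic: \<open>f\<close> injects
  a finite sphere around \<open>x\<close> into the sphere of the same radius around
  \<open>f x\<close>, and transitivity gives both the same cardinality. What remains are conditions
  on two values at a time, which are closed.\<close>

lemma tp_aut_eq:
  "tp_aut C \<delta> = {f \<in> C \<rightarrow>\<^sub>E C. \<forall>x\<in>C. \<forall>y\<in>C. \<delta> (f x) (f y) = \<delta> x y}"
proof (intro equalityI subsetI)
  fix f assume "f \<in> {f \<in> C \<rightarrow>\<^sub>E C. \<forall>x\<in>C. \<forall>y\<in>C. \<delta> (f x) (f y) = \<delta> x y}"
  then have f: "f \<in> C \<rightarrow>\<^sub>E C" "\<And>x y. x \<in> C \<Longrightarrow> y \<in> C \<Longrightarrow> \<delta> (f x) (f y) = \<delta> x y" by auto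
  have fC: "f x \<in> C" if "x \<in> C" for x using f(1) that by auto
  have inj: "inj_on f C"
  proof (rule inj_onI)
    fix x y assume xy: "x \<in> C" "y \<in> C" "f x = f y"
    then have "\<delta> x y = \<one>" using f(2)[of x y] fC by simp
    then show "x = y" using dist_eq_one xy by blast
  qed
  have "y \<in> f ` C" if y: "y \<in> C" for y
  proof -
    obtain x where x: "x \<in> C" using C_nonempty by blast
    define v where "v = \<delta> (f x) y"
    have v: "v \<in> carrier W" using x y fC by (simp add: v_def)
    have sub: "f ` {z \<in> C. \<delta> x z = v} \<subseteq> {z \<in> C. \<delta> (f x) z = v}" using f(2) fC x by auto
    have "card (f ` {z \<in> C. \<delta> x z = v}) = card {z \<in> C. \<delta> (f x) z = v}"
      using card_image[OF inj_on_subset[OF inj], of "{z \<in> C. \<delta> x z = v}"]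
        card_sphere_eq[OF x fC[OF x], of v] by auto
    then have "f ` {z \<in> C. \<delta> x z = v} = {z \<in> C. \<delta> (f x) z = v}"
      using card_subset_eq[OF finite_sphere[OF v fC[OF x]] sub] by blast
    moreover have "y \<in> {z \<in> C. \<delta> (f x) z = v}" using y by (simp add: v_def)
    ultimately show ?thesis by blast
  qed
  then have "bij_betw f C C" using inj fC unfolding bij_betw_def by blast
  then show "f \<in> tp_aut C \<delta>" using f by (auto simp: tp_aut_def PiE_iff)
qed (auto simp: tp_aut_def bij_betw_def PiE_iff)

text \<open>\<open>G\<close> is given closed only among the automorphisms, while compactness is
  tested in the whole product. The automorphisms are closed there because a violation of
  \<open>tp_aut_eq\<close> is visible on two values.\<close>

lemma closedin_G: "closedin (aut_topology C) G"
proof -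
  have open_ne: "openin (aut_topology C) {f \<in> C \<rightarrow>\<^sub>E C. \<delta> (f x) (f y) \<noteq> \<delta> x y}"
    if "x \<in> C" "y \<in> C" for x y
  proof -
    have "{f \<in> C \<rightarrow>\<^sub>E C. \<delta> (f x) (f y) \<noteq> \<delta> x y} =
      (\<Union>(a, b)\<in>{(a, b). \<delta> a b \<noteq> \<delta> x y}. {f \<in> C \<rightarrow>\<^sub>E C. f x \<in> {a}} \<inter> {f \<in> C \<rightarrow>\<^sub>E C. f y \<in> {b}})"
      by auto
    moreover have "openin (aut_topology C) {f \<in> C \<rightarrow>\<^sub>E C. f z = a}" if "z \<in> C" for z a
      using open_eval[OF that, of "{a}"] by simp
    ultimately show ?thesis using that by (auto intro!: openin_Union)
  qed
  have "(C \<rightarrow>\<^sub>E C) - tp_aut C \<delta> = (\<Union>x\<in>C. \<Union>y\<in>C. {f \<in> C \<rightarrow>\<^sub>E C. \<delta> (f x) (f y) \<noteq> \<delta> x y})"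
    unfolding tp_aut_eq by auto
  then have "openin (aut_topology C) ((C \<rightarrow>\<^sub>E C) - tp_aut C \<delta>)"
    by (auto intro!: open_ne)
  moreover have "tp_aut C \<delta> \<subseteq> C \<rightarrow>\<^sub>E C" unfolding tp_aut_eq by blast
  ultimately have "closedin (aut_topology C) (tp_aut C \<delta>)"
    by (simp add: closedin_def topspace_aut)
  then show ?thesis using closed_G closedin_trans_full by blast
qed

text \<open>Inside \<open>G\<close>, the stabiliser restricts only the value at \<open>x\<close>, to
  \<open>R\<close>: a condition both open and closed. Once \<open>f x\<close> ranges over the finite
  set \<open>R\<close>, preservation of distance confines every other value to finitely many finite
  spheres, so the stabiliser is closed in a product of finite sets.\<close>

lemma compact_open_stabilizer:
  assumes sph: "spherical W S J" and x: "x \<in> C"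
  shows "compact_open_subgroup C G (stabilizer G (residue W C \<delta> J x))"
proof -
  have J: "J \<subseteq> S" using sph by (simp add: spherical_def)
  let ?R = "residue W C \<delta> J x" and ?U = "stabilizer G (residue W C \<delta> J x)"
  have U: "?U = G \<inter> {f \<in> C \<rightarrow>\<^sub>E C. f x \<in> ?R}"
    using stabilizer_residue[OF J x] G_PiE by auto
  have "subgroup ?U \<Gamma>"
  proof (rule aut.subgroupI)
    show "?U \<subseteq> carrier \<Gamma>" by (auto simp: stabilizer_def)
    have "\<one>\<^bsub>\<Gamma>\<^esub> \<in> ?U" using stabilizer_residue[OF J x] residue_self[OF J x] x one_\<Gamma>_closed by simp
    then show "?U \<noteq> {}" by blast
    show "inv\<^bsub>\<Gamma>\<^esub> h \<in> ?U" if "h \<in> ?U" for h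
      using that image_inv_\<Gamma>[of h ?R ?R] residue_subset by (simp add: stabilizer_def)
    show "h \<otimes>\<^bsub>\<Gamma>\<^esub> k \<in> ?U" if "h \<in> ?U" "k \<in> ?U" for h k
      using that image_mult_\<Gamma>[OF residue_subset, of h k] mult_\<Gamma>_closed by (simp add: stabilizer_def)
  qed
  moreover have "openin (subtopology (aut_topology C) G) ?U"
    unfolding U by (rule openin_subtopology_Int2) (rule open_eval[OF x])
  moreover have "compactin (aut_topology C) ?U"
  proof (rule closed_compactin)
    define K where "K y = (\<Union>z\<in>?R. {y' \<in> C. \<delta> z y' = \<delta> x y})" for y
    have fin: "finite (K y)" if "y \<in> C" for y
      unfolding K_def
    proof (rule finite_UN_I[OF finite_residue[OF sph x]])
      fix z assume "z \<in> ?R"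
      then show "finite {y' \<in> C. \<delta> z y' = \<delta> x y}"
        using finite_sphere[of "\<delta> x y" z] that x residue_subset by auto
    qed
    then show "compactin (aut_topology C) (PiE C K)"
      unfolding aut_topology_def compactin_PiE using fin
      by (auto simp: compactin_discrete_topology) (auto simp: K_def)
    show "?U \<subseteq> PiE C K"
    proof
      fix f assume f: "f \<in> ?U"
      then have "f \<in> G" "f x \<in> ?R" unfolding U by auto
      then show "f \<in> PiE C K" using x G_extensional by (auto simp: PiE_iff K_def intro!: bexI[of _ "f x"])
    qed
    show "closedin (aut_topology C) ?U"
      unfolding U by (intro closedin_Int closedin_G closed_eval x)
  qed
  ultimately show ?thesis by (simp add: compact_open_subgroup_def perm_subgroup_iff)
qed

lemma compact_open_Int:
  assumes "compact_open_subgroup C G U" "compact_open_subgroup C G V"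
  shows "compact_open_subgroup C G (U \<inter> V)"
proof -
  have "Hausdorff_space (aut_topology C)"
    unfolding aut_topology_def by (simp add: Hausdorff_space_product_topology)
  then have "closedin (aut_topology C) U"
    using assms(1) compactin_imp_closedin unfolding compact_open_subgroup_def by blast
  then have "compactin (aut_topology C) (U \<inter> V)"
    using assms(2) closed_Int_compactin unfolding compact_open_subgroup_def by blast
  then show ?thesis using assms aut.subgroups_Inter_pair
    by (auto simp: compact_open_subgroup_def perm_subgroup_iff intro: openin_Int)
qed

lemma open_contains_fixator:
  assumes "openin (subtopology (aut_topology C) G) V" "h \<in> V"
  obtains F where "finite F" "F \<subseteq> C" "\<And>f. f \<in> G \<Longrightarrow> (\<And>x. x \<in> F \<Longrightarrow> f x = h x) \<Longrightarrow> f \<in> V"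
proof -
  obtain T where T: "openin (aut_topology C) T" "V = T \<inter> G"
    using assms(1) by (auto simp: openin_subtopology)
  obtain B where B: "finite {i \<in> C. B i \<noteq> C}" "h \<in> PiE C B" "PiE C B \<subseteq> T"
    using T assms(2) unfolding aut_topology_def openin_product_topology_alt by auto
  have "f \<in> V" if f: "f \<in> G" "\<And>x. x \<in> {i \<in> C. B i \<noteq> C} \<Longrightarrow> f x = h x" for f
  proof -
    have "f i \<in> B i" if i: "i \<in> C" for i
    proof (cases "B i = C")
      case False
      then show ?thesis using f(2)[of i] i B(2) by auto
    qed (use f i in simp)
    then have "f \<in> PiE C B" using G_extensional[OF f(1)] by (simp add: PiE_iff)
    then show ?thesis using B(3) T(2) f(1) by blast
  qed
  then show ?thesis using that[of "{i \<in> C. B i \<noteq> C}"] B(1) by auto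
qed

lemma compact_finite_orbit:
  assumes "compactin (aut_topology C) K" "y \<in> C"
  shows "finite ((\<lambda>h. h y) ` K)"
proof -
  have "continuous_map (aut_topology C) (discrete_topology C) (\<lambda>f. f y)"
    unfolding aut_topology_def by (rule continuous_map_product_projection[OF assms(2)])
  then have "compactin (discrete_topology C) ((\<lambda>h. h y) ` K)"
    using assms(1) image_compactin by blast
  then show ?thesis by (simp add: compactin_discrete_topology)
qed

text \<open>A neighbourhood of the identity contains the fixator of a finite set \<open>F\<close>,
  so elements of \<open>K\<close> that agree on \<open>F\<close> lie in one coset of
  \<open>V\<close>, and finite orbits leave finitely many restrictions to \<open>F\<close>. The
  hypothesis speaks of orbits so that a conjugate of a compact group qualifies without any
  continuity of conjugation.\<close>

lemma left_covered_open:
  assumes K: "K \<subseteq> G" "\<And>y. y \<in> C \<Longrightarrow> finite ((\<lambda>h. h y) ` K)"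
    and V: "openin (subtopology (aut_topology C) G) V" "subgroup V \<Gamma>"
  shows "\<exists>n. left_covered \<Gamma> K V n"
proof -
  obtain F where F: "finite F" "F \<subseteq> C" "\<And>f. f \<in> G \<Longrightarrow> (\<And>x. x \<in> F \<Longrightarrow> f x = \<one>\<^bsub>\<Gamma>\<^esub> x) \<Longrightarrow> f \<in> V"
    using open_contains_fixator[OF V(1) subgroup.one_closed[OF V(2)]] by blast
  let ?r = "\<lambda>h. restrict h F"
  have "?r ` K \<subseteq> PiE F (\<lambda>y. (\<lambda>h. h y) ` K)" by auto
  then have fin: "finite (?r ` K)"
    using finite_PiE[OF F(1), of "\<lambda>y. (\<lambda>h. h y) ` K"] K(2) F(2) finite_subset by blast
  let ?E = "inv_into K ?r ` ?r ` K"
  have EK: "?E \<subseteq> K" by (auto intro: inv_into_into)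
  have "\<exists>e\<in>?E. \<exists>v\<in>V. h = e \<otimes>\<^bsub>\<Gamma>\<^esub> v" if h: "h \<in> K" for h
  proof -
    define e where "e = inv_into K ?r (?r h)"
    have "e \<in> ?E" using h by (auto simp: e_def)
    moreover have "?r e = ?r h" using f_inv_into_f[of "?r h" ?r K] h by (simp add: e_def)
    ultimately have e: "e \<in> ?E" "?r e = ?r h" by blast+
    have eG: "e \<in> G" "h \<in> G" using e EK K h by auto
    have "(inv\<^bsub>\<Gamma>\<^esub> e \<otimes>\<^bsub>\<Gamma>\<^esub> h) x = \<one>\<^bsub>\<Gamma>\<^esub> x" if x: "x \<in> F" for x
    proof -
      have "h x = e x" using fun_cong[OF e(2), of x] x by simp
      then show ?thesis using x F(2) eG by (simp add: subset_eq)
    qed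
    then have "inv\<^bsub>\<Gamma>\<^esub> e \<otimes>\<^bsub>\<Gamma>\<^esub> h \<in> V" using F(3) eG mult_\<Gamma>_closed by simp
    moreover have "h = e \<otimes>\<^bsub>\<Gamma>\<^esub> (inv\<^bsub>\<Gamma>\<^esub> e \<otimes>\<^bsub>\<Gamma>\<^esub> h)"
      using eG by (intro G_eqI) (simp_all add: mult_\<Gamma>_closed)
    ultimately show ?thesis using e by blast
  qed
  then have "left_covered \<Gamma> K V (card ?E)"
    unfolding left_covered_def using fin EK K by (intro exI[of _ ?E]) auto
  then show ?thesis by blast
qed

section \<open>Conjugation indices of compact open subgroups\<close>

lemma conj_index_le:
  assumes "left_covered \<Gamma> (conj_by \<Gamma> g V) V n" "compact_open_subgroup C G V" "g \<in> G"
  shows "conj_index C g V \<le> n"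
proof -
  have V: "subgroup V \<Gamma>" "V \<subseteq> G"
    using assms(2) subgroup.subset by (fastforce simp: compact_open_subgroup_def perm_subgroup_iff)+
  show ?thesis
    unfolding conj_index_eq[OF V(2) assms(3)]
    using aut.coset_card_le(2)[OF assms(1) aut.subgroup_conj_by[OF V(1)] V(1)] assms(3) by simp
qed

text \<open>This makes the \<open>card\<close> in \<open>conj_index\<close> a true index: the orbit
  of \<open>y\<close> under the conjugate is the \<open>g\<close>-image of the orbit of
  \<open>g^-1 y\<close> under \<open>V\<close>, hence finite, and \<open>left_covered_open\<close>
  applies.\<close>

lemma left_covered_conj_index:
  assumes "compact_open_subgroup C G V" "g \<in> G"
  shows "left_covered \<Gamma> (conj_by \<Gamma> g V) V (conj_index C g V)"
proof -
  have V: "subgroup V \<Gamma>" "V \<subseteq> G" "openin (subtopology (aut_topology C) G) V"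
      "compactin (aut_topology C) V"
    using assms(1) subgroup.subset by (fastforce simp: compact_open_subgroup_def perm_subgroup_iff)+
  have P: "subgroup (conj_by \<Gamma> g V) \<Gamma>" using aut.subgroup_conj_by[OF V(1)] assms(2) by simp
  have "finite ((\<lambda>h. h y) ` conj_by \<Gamma> g V)" if y: "y \<in> C" for y
  proof -
    have "(\<lambda>h. h y) ` conj_by \<Gamma> g V = g ` (\<lambda>h. h ((inv\<^bsub>\<Gamma>\<^esub> g) y)) ` V"
      using y assms(2) by (simp add: conj_by_def image_image)
    then show ?thesis using compact_finite_orbit[OF V(4)] assms(2) y by simp
  qed
  then obtain n where "left_covered \<Gamma> (conj_by \<Gamma> g V) V n"
    using left_covered_open[OF _ _ V(3,1)] subgroup.subset[OF P] by fastforce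
  from aut.coset_card_le(1)[OF this P V(1)] show ?thesis
    unfolding conj_index_eq[OF V(2) assms(2)] using aut.coset_covered P V(1) by blast
qed

lemma left_covered_compact_open:
  assumes "compact_open_subgroup C G U" "compact_open_subgroup C G V"
  shows "\<exists>n. left_covered \<Gamma> U V n"
proof (rule left_covered_open)
  show "U \<subseteq> G" using assms(1) by (auto simp: compact_open_subgroup_def perm_subgroup_def)
qed (use assms compact_finite_orbit in \<open>auto simp: compact_open_subgroup_def perm_subgroup_iff\<close>)

end

section \<open>Tidiness and straightness\<close>

locale moved_residue = weyl_transitive_group W S C \<delta> G
  for W :: "('w, 'b) monoid_scheme" (structure) and S :: "'w set"
    and C :: "'c set" and \<delta> :: "'c \<Rightarrow> 'c \<Rightarrow> 'w" and G :: "('c \<Rightarrow> 'c) set" +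
  fixes J :: "'w set" and x :: 'c and g :: "'c \<Rightarrow> 'c"
  assumes spherical: "spherical W S J" and x [simp]: "x \<in> C" and g [simp]: "g \<in> G"
begin

abbreviation R :: "'c set" where "R \<equiv> residue W C \<delta> J x"
abbreviation A :: "'w set" where "A \<equiv> parabolic W J"
abbreviation U :: "('c \<Rightarrow> 'c) set" where "U \<equiv> stabilizer G R"
abbreviation w :: 'w where "w \<equiv> simplex_dist W S \<delta> R (g ` R)"
abbreviation gpow :: "nat \<Rightarrow> 'c \<Rightarrow> 'c" where "gpow k \<equiv> g [^]\<^bsub>\<Gamma>\<^esub> k"

lemma J: "J \<subseteq> S" and finite_A: "finite A"
  using spherical by (auto simp: spherical_def)

lemma A_subgroup: "subgroup A W"
  by (rule parabolic_subgroup[OF J])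

lemma A_carrier [simp]: "u \<in> A \<Longrightarrow> u \<in> carrier W"
  by (rule subgroup.mem_carrier[OF A_subgroup])

lemma A_inv [simp]: "u \<in> A \<Longrightarrow> inv u \<in> A"
  by (rule subgroup.m_inv_closed[OF A_subgroup])

lemma A_mult [simp]: "u \<in> A \<Longrightarrow> v \<in> A \<Longrightarrow> u \<otimes> v \<in> A"
  by (rule subgroup.m_closed[OF A_subgroup])

lemma A_one [simp]: "\<one> \<in> A"
  by (rule subgroup.one_closed[OF A_subgroup])

lemma w_mem: "w \<in> double_coset J (\<delta> x (g x))"
  and w_min': "v \<in> double_coset J (\<delta> x (g x)) \<Longrightarrow> len w \<le> len v"
  using simplex_dist_min[OF J x, of "g x"] by (simp_all add: image_residue)

lemma w_carrier [simp]: "w \<in> carrier W"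
  using double_coset_carrier[OF J, of "\<delta> x (g x)"] w_mem by auto

lemma dc_w: "double_coset J (\<delta> x (g x)) = double_coset J w"
  using double_coset_eq[OF J _ w_mem] by simp

lemma w_min: "v \<in> double_coset J w \<Longrightarrow> len w \<le> len v"
  using w_min' by (simp add: dc_w)

lemma dcI: "a \<in> A \<Longrightarrow> b \<in> A \<Longrightarrow> v = a \<otimes> u \<otimes> b \<Longrightarrow> v \<in> double_coset J u"
  unfolding double_coset_def by blast

lemma gpow_G [simp]: "gpow k \<in> G"
  using aut.nat_pow_closed[of g k] by simp

lemma gpow_0: "y \<in> C \<Longrightarrow> gpow 0 y = y"
  by simp

lemma gpow_Suc': "y \<in> C \<Longrightarrow> gpow (Suc k) y = gpow k (g y)"
  by simp

lemma gpow_R: "gpow k ` R = residue W C \<delta> J (gpow k x)"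
  by (simp add: image_residue)

lemma R_C: "R \<subseteq> C"
  by (rule residue_subset)

lemma gpow_R_C: "gpow k ` R \<subseteq> C"
  unfolding gpow_R by (rule residue_subset)

lemma image_gpow_R: "g ` (gpow k ` R) = gpow (Suc k) ` R"
  using image_mult_\<Gamma>[OF R_C, of g "gpow k"] aut.nat_pow_Suc2[of g k] by simp

lemma dist_gpow_Suc:
  assumes "p \<in> gpow k ` R" "q \<in> gpow (Suc k) ` R"
  shows "\<delta> p q \<in> double_coset J w"
proof -
  have "\<delta> p q \<in> double_coset J (\<delta> (gpow k x) (gpow (Suc k) x))"
    using residue_dist_set[OF J, of "gpow k x" "gpow (Suc k) x"] assms unfolding gpow_R by auto
  moreover have "\<delta> (gpow k x) (gpow (Suc k) x) = \<delta> x (g x)"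
    using gpow_Suc'[OF x, of k] by simp
  ultimately show ?thesis by (simp only: dc_w)
qed

lemma compact_open_U: "compact_open_subgroup C G U"
  by (rule compact_open_stabilizer[OF spherical x])

lemma U_G: "U \<subseteq> G"
  by (auto simp: stabilizer_def)

lemma mem_U: "h \<in> G \<Longrightarrow> h \<in> U \<longleftrightarrow> h x \<in> R"
  using stabilizer_residue[OF J x] by blast

lemma conj_by_image:
  assumes "h \<in> conj_by \<Gamma> f V" "f \<in> G" "V \<subseteq> G" "B \<subseteq> C" "\<And>v. v \<in> V \<Longrightarrow> v ` B = B"
  shows "h \<in> G" "h ` (f ` B) = f ` B"
proof -
  obtain v where v: "v \<in> V" "h = f \<otimes>\<^bsub>\<Gamma>\<^esub> v \<otimes>\<^bsub>\<Gamma>\<^esub> inv\<^bsub>\<Gamma>\<^esub> f" using assms(1) by (auto simp: conj_by_def)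
  then show "h \<in> G" using assms mult_\<Gamma>_closed by auto
  have "h ` (f ` B) = (\<lambda>b. f (v b)) ` B"
    unfolding image_image
  proof (rule image_cong[OF refl])
    fix b assume b: "b \<in> B"
    then have "b \<in> C" using assms(4) by blast
    moreover have "v \<in> G" using v assms by blast
    ultimately show "h (f b) = f (v b)" using v assms(2) by simp
  qed
  also have "\<dots> = f ` B" using assms(5)[OF v(1)] by (metis image_image)
  finally show "h ` (f ` B) = f ` B" .
qed

lemma conj_byI:
  assumes "h \<in> G" "f \<in> G" "(inv\<^bsub>\<Gamma>\<^esub> f \<otimes>\<^bsub>\<Gamma>\<^esub> h) \<otimes>\<^bsub>\<Gamma>\<^esub> f \<in> V"
  shows "h \<in> conj_by \<Gamma> f V"
proof -
  have eq: "f \<otimes>\<^bsub>\<Gamma>\<^esub> ((inv\<^bsub>\<Gamma>\<^esub> f \<otimes>\<^bsub>\<Gamma>\<^esub> h) \<otimes>\<^bsub>\<Gamma>\<^esub> f) \<otimes>\<^bsub>\<Gamma>\<^esub> inv\<^bsub>\<Gamma>\<^esub> f = h"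
    using assms(1,2) by (intro G_eqI) (simp_all add: mult_\<Gamma>_closed)
  show ?thesis unfolding conj_by_def by (intro image_eqI[OF _ assms(3)]) (simp only: eq)
qed

subsection \<open>Straight displacement implies tidiness\<close>

text \<open>When \<open>w\<close> normalises \<open>A\<close>, the double coset \<open>A w A\<close>
  is \<open>A w\<close>; so a change of the first chamber within its residue reaches distance
  exactly \<open>w\<close>, and \<open>y\<close> can stay put.\<close>

lemma move_to_distance_w:
  assumes norm: "\<And>u. u \<in> A \<Longrightarrow> w \<otimes> u \<otimes> inv w \<in> A"
    and "p \<in> C" "y \<in> C" "\<delta> p y \<in> double_coset J w"
  obtains p' where "p' \<in> residue W C \<delta> J p" "\<delta> p' y = w"
proof -
  obtain a b where ab: "a \<in> A" "b \<in> A" "\<delta> p y = a \<otimes> w \<otimes> b"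
    using assms(4) unfolding double_coset_def by blast
  define c where "c = a \<otimes> (w \<otimes> b \<otimes> inv w)"
  have c: "c \<in> A" using ab norm by (simp add: c_def)
  have "\<delta> p y = c \<otimes> w" using ab by (simp add: c_def m_assoc)
  obtain p' where p': "p' \<in> C" "\<delta> p' p = inv c" "\<delta> p' y = inv c \<otimes> (c \<otimes> w)"
    using left_exist_mult[of "inv c" p y] assms(2,3) c \<open>\<delta> p y = c \<otimes> w\<close> by auto
  have "\<delta> p p' = c" using dist_inv[of p' p] p' c assms by simp
  moreover have "\<delta> p' y = w" using p' c by (simp flip: m_assoc)
  moreover have "p' \<in> residue W C \<delta> J p" using p'(1) \<open>\<delta> p p' = c\<close> c by (simp add: residue_def)
  ultimately show ?thesis using that by blast
qed

text \<open>Work back from \<open>y\<close> through the residues \<open>g^k R\<close>, always at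
  distance exactly \<open>w\<close>; since lengths add, the distances multiply to
  \<open>w^n\<close>.\<close>

lemma dist_w_pow:
  assumes norm: "\<And>u. u \<in> A \<Longrightarrow> w \<otimes> u \<otimes> inv w \<in> A"
    and len_pow: "\<And>n::nat. len (w [^] n) = n * len w"
    and "y \<in> gpow n ` R"
  shows "\<exists>p\<in>R. \<delta> p y = w [^] n"
  using assms(3)
proof (induction n arbitrary: y)
  case 0
  then obtain p where "p \<in> R" "y = gpow 0 p" by blast
  moreover have "gpow 0 p = p" using \<open>p \<in> R\<close> R_C by (intro gpow_0) blast
  ultimately show ?case using R_C by (intro bexI[of _ p]) auto
next
  case (Suc n)
  have y: "y \<in> C" using Suc.prems gpow_R_C by blast
  have q: "gpow n x \<in> gpow n ` R" using residue_self[OF J x] by blast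
  obtain z where z: "z \<in> residue W C \<delta> J (gpow n x)" "\<delta> z y = w"
    by (rule move_to_distance_w[OF norm _ y dist_gpow_Suc[OF q Suc.prems]]) simp_all
  then have "z \<in> gpow n ` R" unfolding gpow_R by simp
  then obtain p where p: "p \<in> R" "\<delta> p z = w [^] n" using Suc.IH by blast
  have "len (w [^] n \<otimes> w) = len (w [^] n) + len w"
    using len_pow[of "Suc n"] len_pow[of n] by simp
  then have "\<delta> p y = w [^] n \<otimes> w"
    by (intro left_mult[of _ p y z]) (use p z y R_C residue_subset[of J "gpow n x"] in auto)
  then show ?case using p by auto
qed

section \<open>Counting chambers at a given distance\<close>

definition nbr :: "'w \<Rightarrow> nat" where
  "nbr v = card {p \<in> C. \<delta> p x = v}"

lemma dist_sphere_eq: "v \<in> carrier W \<Longrightarrow> y \<in> C \<Longrightarrow> {p \<in> C. \<delta> p y = v} = {p \<in> C. \<delta> y p = inv v}"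
  by (metis (mono_tags, lifting) dist_closed dist_inv inv_inv)

text \<open>The count varies the first argument of \<open>\<delta>\<close>, the end at which
  distances are extended here; inversion turns it into a sphere, whose size is the same everywhere
  by transitivity.\<close>

lemma card_nbr: "v \<in> carrier W \<Longrightarrow> y \<in> C \<Longrightarrow> card {p \<in> C. \<delta> p y = v} = nbr v"
  unfolding nbr_def using dist_sphere_eq[of v] card_sphere_eq[of y x "inv v"] by simp

lemma finite_nbr: "v \<in> carrier W \<Longrightarrow> y \<in> C \<Longrightarrow> finite {p \<in> C. \<delta> p y = v}"
  using dist_sphere_eq[of v] finite_sphere[of "inv v" y] by simp

text \<open>Each \<open>z\<close> with \<open>\<delta> z x = v\<close> and each \<open>p\<close>
  with \<open>\<delta> p z = u\<close> give \<open>\<delta> p x = u v\<close>, and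
  \<open>split_unique\<close> recovers \<open>z\<close> from \<open>p\<close>.\<close>

lemma nbr_mult:
  assumes "u \<in> carrier W" "v \<in> carrier W" "len (u \<otimes> v) = len u + len v"
  shows "nbr u * nbr v \<le> nbr (u \<otimes> v)"
proof -
  let ?Z = "{z \<in> C. \<delta> z x = v}" and ?P = "\<lambda>z. {p \<in> C. \<delta> p z = u}"
  have "card (\<Union>z\<in>?Z. ?P z) = (\<Sum>z\<in>?Z. card (?P z))"
  proof (rule card_UN_disjoint)
    show "finite ?Z" using finite_nbr assms by simp
    show "\<forall>z\<in>?Z. finite (?P z)" using finite_nbr assms by simp
    show "\<forall>z\<in>?Z. \<forall>z'\<in>?Z. z \<noteq> z' \<longrightarrow> ?P z \<inter> ?P z' = {}"
    proof (intro ballI impI equals0I)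
      fix z z' p assume "z \<in> ?Z" "z' \<in> ?Z" "z \<noteq> z'" "p \<in> ?P z \<inter> ?P z'"
      then show False using split_unique[of u p x z z' v] assms by auto
    qed
  qed
  also have "\<dots> = (\<Sum>z\<in>?Z. nbr u)" using card_nbr assms(1) by (intro sum.cong) auto
  also have "\<dots> = nbr u * nbr v" by (simp add: nbr_def)
  finally have "nbr u * nbr v = card (\<Union>z\<in>?Z. ?P z)" by simp
  also have "\<dots> \<le> nbr (u \<otimes> v)"
    unfolding nbr_def
  proof (rule card_mono)
    show "finite {p \<in> C. \<delta> p x = u \<otimes> v}" using finite_nbr assms by simp
    show "(\<Union>z\<in>?Z. ?P z) \<subseteq> {p \<in> C. \<delta> p x = u \<otimes> v}"
    proof
      fix p assume "p \<in> (\<Union>z\<in>?Z. ?P z)"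
      then obtain z where "z \<in> C" "\<delta> z x = v" "p \<in> C" "\<delta> p z = u" by blast
      then show "p \<in> {p \<in> C. \<delta> p x = u \<otimes> v}" using left_mult[of u p x z v] assms by simp
    qed
  qed
  finally show ?thesis .
qed

lemma nbr_pow:
  assumes len_pow: "\<And>n::nat. len (w [^] n) = n * len w"
  shows "nbr w ^ n \<le> nbr (w [^] n)"
proof (induction n)
  case 0
  have "{p \<in> C. \<delta> p x = \<one>} = {x}" using dist_eq_one by auto
  then show ?case by (simp add: nbr_def)
next
  case (Suc n)
  have "len (w [^] n \<otimes> w) = len (w [^] n) + len w"
    using len_pow[of "Suc n"] len_pow[of n] by simp
  then have "nbr (w [^] n) * nbr w \<le> nbr (w [^] Suc n)" using nbr_mult[of "w [^] n" w] by simp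
  moreover have "nbr w ^ Suc n \<le> nbr (w [^] n) * nbr w"
    using mult_le_mono1[OF Suc] by (simp add: mult.commute)
  ultimately show ?case by (rule order_trans[rotated])
qed

text \<open>An element \<open>h\<close> of \<open>g U g^-1\<close> fixes \<open>g R\<close>, so
  distances from \<open>h R\<close> to \<open>g R\<close> still form \<open>A w A\<close>, and
  \<open>h R\<close> contains a chamber \<open>p\<close> with \<open>\<delta> p (g x) = w\<close>.
  The coset \<open>h U\<close> depends only on \<open>h R\<close>, hence on
  \<open>p\<close>.\<close>

lemma conj_index_U_le:
  assumes norm: "\<And>u. u \<in> A \<Longrightarrow> w \<otimes> u \<otimes> inv w \<in> A"
  shows "conj_index C g U \<le> nbr w"
proof (rule conj_index_le[OF _ compact_open_U g])
  have "\<exists>f. f \<in> G \<and> f x = p" if p: "p \<in> C" for p using transitive[OF x p] by blast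
  then obtain t where t: "\<And>p. p \<in> C \<Longrightarrow> t p \<in> G \<and> t p x = p" by metis
  let ?F = "t ` {p \<in> C. \<delta> p (g x) = w}"
  have "\<exists>f\<in>?F. \<exists>v\<in>U. h = f \<otimes>\<^bsub>\<Gamma>\<^esub> v" if h: "h \<in> conj_by \<Gamma> g U" for h
  proof -
    have h: "h \<in> G" "h ` (g ` R) = g ` R"
      using conj_by_image[OF h g U_G R_C] by (auto simp: stabilizer_def)
    have gx: "g x \<in> g ` R" using residue_self[OF J x] by blast
    have "g x \<in> h ` (g ` R)" using gx h(2) by simp
    then have "g x \<in> residue W C \<delta> J (h (g x))" using h(1) by (simp add: image_residue)
    moreover have "h x \<in> residue W C \<delta> J (h x)" using residue_self[OF J] h(1) by simp
    ultimately have "\<delta> (h x) (g x) \<in> double_coset J (\<delta> (h x) (h (g x)))"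
      using residue_dist_set[OF J, of "h x" "h (g x)"] h(1) by auto
    then have "\<delta> (h x) (g x) \<in> double_coset J w" using h(1) dc_w by simp
    then obtain p where p: "p \<in> residue W C \<delta> J (h x)" "\<delta> p (g x) = w"
      using move_to_distance_w[OF norm, of "h x" "g x"] h(1) by auto
    have pC: "p \<in> C" using p residue_subset by blast
    have tp: "t p \<in> G" "t p x = p" using t pC by blast+
    have "t p ` R = residue W C \<delta> J (h x)"
      using residue_eq[OF J _ p(1)] tp h(1) by (simp add: image_residue)
    then have "h x \<in> t p ` R" using residue_self[OF J] h(1) by simp
    then obtain r where r: "r \<in> R" "h x = t p r" by blast
    have rC: "r \<in> C" using r R_C by blast
    have "(inv\<^bsub>\<Gamma>\<^esub> (t p) \<otimes>\<^bsub>\<Gamma>\<^esub> h) x = r" using r(2) rC tp h(1) by simp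
    then have "inv\<^bsub>\<Gamma>\<^esub> (t p) \<otimes>\<^bsub>\<Gamma>\<^esub> h \<in> U" using mem_U tp h(1) r(1) mult_\<Gamma>_closed by simp
    moreover have "h = t p \<otimes>\<^bsub>\<Gamma>\<^esub> (inv\<^bsub>\<Gamma>\<^esub> (t p) \<otimes>\<^bsub>\<Gamma>\<^esub> h)"
      using tp h(1) by (intro G_eqI) (simp_all add: mult_\<Gamma>_closed)
    ultimately show ?thesis using p pC by blast
  qed
  moreover have "finite {p \<in> C. \<delta> p (g x) = w}" by (rule finite_nbr) simp_all
  moreover from this have "card ?F \<le> nbr w" using card_image_le card_nbr[of w "g x"] by fastforce
  moreover have "?F \<subseteq> G" using t by blast
  ultimately show "left_covered \<Gamma> (conj_by \<Gamma> g U) U (nbr w)"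
    unfolding left_covered_def by (intro exI[of _ ?F]) auto
qed

text \<open>By Weyl transitivity every \<open>p\<close> with \<open>\<delta> p y = w^n\<close> is
  \<open>h p0\<close> for some \<open>h\<close> fixing \<open>y\<close>, which puts \<open>h\<close>
  into the conjugate of \<open>U\<close>. So \<open>p\<close> lies in one of at most
  \<open>m\<close> translates of \<open>R\<close>, whence the factor \<open>card R\<close>.\<close>

lemma nbr_pow_le_cover:
  assumes norm: "\<And>u. u \<in> A \<Longrightarrow> w \<otimes> u \<otimes> inv w \<in> A"
    and len_pow: "\<And>n::nat. len (w [^] n) = n * len w"
    and cov: "left_covered \<Gamma> (conj_by \<Gamma> (gpow n) U) U m"
  shows "nbr (w [^] n) \<le> m * card R"
proof -
  obtain F where F: "finite F" "card F \<le> m" "F \<subseteq> G"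
      "\<forall>h\<in>conj_by \<Gamma> (gpow n) U. \<exists>f\<in>F. \<exists>v\<in>U. h = f \<otimes>\<^bsub>\<Gamma>\<^esub> v"
    using cov unfolding left_covered_def by auto
  define y where "y = gpow n x"
  have yC: "y \<in> C" by (simp add: y_def)
  have "y \<in> gpow n ` R" using residue_self[OF J x] by (simp add: y_def)
  then obtain p0 where p0: "p0 \<in> R" "\<delta> p0 y = w [^] n" using dist_w_pow[OF norm len_pow] by blast
  have p0C: "p0 \<in> C" using p0 R_C by blast
  have sub: "{p \<in> C. \<delta> p y = w [^] n} \<subseteq> (\<Union>f\<in>F. f ` R)"
  proof
    fix p assume p: "p \<in> {p \<in> C. \<delta> p y = w [^] n}"
    obtain h where h: "h \<in> G" "h p0 = p" "h y = y"
      by (rule transitive_on_pairs[of p0 y p y]) (use p p0 p0C yC in auto)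
    have "h \<in> conj_by \<Gamma> (gpow n) U"
    proof (rule conj_byI[OF h(1)])
      have "((inv\<^bsub>\<Gamma>\<^esub> (gpow n) \<otimes>\<^bsub>\<Gamma>\<^esub> h) \<otimes>\<^bsub>\<Gamma>\<^esub> gpow n) x = x"
        using h by (simp add: y_def)
      then show "(inv\<^bsub>\<Gamma>\<^esub> (gpow n) \<otimes>\<^bsub>\<Gamma>\<^esub> h) \<otimes>\<^bsub>\<Gamma>\<^esub> gpow n \<in> U"
        using mem_U residue_self[OF J x] h(1) mult_\<Gamma>_closed by simp
    qed simp
    then obtain f v where fv: "f \<in> F" "v \<in> U" "h = f \<otimes>\<^bsub>\<Gamma>\<^esub> v" using bspec[OF F(4)] by blast
    have "v p0 \<in> R" using fv(2) p0(1) by (auto simp: stabilizer_def)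
    moreover have "p = f (v p0)" using fv(3) h(2) p0C by simp
    ultimately show "p \<in> (\<Union>f\<in>F. f ` R)" using fv(1) by blast
  qed
  have finR: "finite R" by (rule finite_residue[OF spherical x])
  have "nbr (w [^] n) = card {p \<in> C. \<delta> p y = w [^] n}" using card_nbr yC by simp
  also have "\<dots> \<le> card (\<Union>f\<in>F. f ` R)" by (rule card_mono[OF _ sub]) (use F(1) finR in simp)
  also have "\<dots> \<le> (\<Sum>f\<in>F. card (f ` R))" by (rule card_UN_le[OF F(1)])
  also have "\<dots> \<le> (\<Sum>f\<in>F. card R)" by (intro sum_mono card_image_le finR)
  also have "\<dots> \<le> m * card R" using F(2) by simp
  finally show ?thesis .
qed

lemma le_if_pow_le_const_pow:
  fixes d e K :: nat
  assumes "\<And>n. d ^ n \<le> K * e ^ n"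
  shows "d \<le> e"
proof (rule ccontr)
  assume "\<not> d \<le> e"
  then have de: "e < d" by simp
  have "e \<noteq> 0" using assms[of 1] de by (cases e) auto
  then have "1 < real d / real e" using de by simp
  then obtain n where "real K < (real d / real e) ^ n" using real_arch_pow by blast
  then have "real K * real e ^ n < real d ^ n" using \<open>e \<noteq> 0\<close> by (simp add: power_divide field_simps)
  then have "K * e ^ n < d ^ n" by (metis of_nat_less_iff of_nat_mult of_nat_power)
  then show False using assms[of n] by simp
qed

lemma straight_imp_tidy:
  assumes "straight W S J w"
  shows "tidy C G g U"
proof -
  have wJ: "(\<lambda>i. w \<otimes> i \<otimes> inv w) ` J = J" and len_pow: "len (w [^] n) = n * len w" for n :: nat
    using assms unfolding straight_def by blast+
  have norm: "w \<otimes> u \<otimes> inv w \<in> A" if u: "u \<in> A" for u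
    using J u
  proof (induction rule: gen_mult_induct)
    case one
    then show ?case by simp
  next
    case (step s u)
    have "w \<otimes> s \<otimes> inv w \<in> J" using wJ step(1) by blast
    then have "w \<otimes> s \<otimes> inv w \<in> A" by (simp add: parabolic_def generate.incl)
    moreover have "w \<otimes> (s \<otimes> u) \<otimes> inv w = (w \<otimes> s \<otimes> inv w) \<otimes> (w \<otimes> u \<otimes> inv w)"
    proof -
      have c: "s \<in> carrier W" "u \<in> carrier W" using step J by auto
      have "inv w \<otimes> (w \<otimes> (u \<otimes> inv w)) = u \<otimes> inv w" using c by (simp flip: m_assoc)
      then show ?thesis using c by (simp add: m_assoc)
    qed
    ultimately show ?case using step by simp
  qed
  have "conj_index C g U \<le> conj_index C g V" if V: "compact_open_subgroup C G V" for V
  proof -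
    let ?e = "conj_index C g V"
    have VG: "subgroup V \<Gamma>" "V \<subseteq> carrier \<Gamma>"
      using V by (auto simp: compact_open_subgroup_def perm_subgroup_iff dest: subgroup.mem_carrier)
    obtain k r where kr: "left_covered \<Gamma> U V k" "left_covered \<Gamma> V U r"
      using left_covered_compact_open compact_open_U V by blast
    \<comment> \<open>The constant collects the comparison of \<open>U\<close> with \<open>V\<close>
      in both directions and the size of a residue, all independent of \<open>n\<close>.\<close>
    have "nbr w ^ n \<le> (k * r * card R) * ?e ^ n" for n
    proof -
      have "left_covered \<Gamma> (conj_by \<Gamma> (gpow n) V) V (?e ^ n)"
        using aut.left_covered_conj_pow[OF left_covered_conj_index[OF V g] VG(1)] by simp
      then have "left_covered \<Gamma> (conj_by \<Gamma> (gpow n) U) U (k * ?e ^ n * r)"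
        using aut.left_covered_conj_compare[OF kr] VG(2) U_G by simp
      then have "nbr (w [^] n) \<le> k * ?e ^ n * r * card R"
        using nbr_pow_le_cover[OF norm len_pow] by blast
      then show ?thesis using nbr_pow[OF len_pow, of n] by (simp add: ac_simps)
    qed
    then have "nbr w \<le> ?e" by (rule le_if_pow_le_const_pow)
    then show ?thesis using conj_index_U_le[OF norm] by simp
  qed
  then show ?thesis unfolding tidy_def using compact_open_U by blast
qed

end

context moved_residue
begin

subsection \<open>Tidiness implies straight displacement\<close>

definition path_stab :: "nat \<Rightarrow> ('c \<Rightarrow> 'c) set" where
  "path_stab n = {h \<in> G. \<forall>k\<le>n. h ` (gpow k ` R) = gpow k ` R}"

text \<open>The conjugate of \<open>path_stab n\<close> by \<open>g\<close>. Of the residues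
  defining \<open>path_stab n\<close>, its elements can move only \<open>R\<close>, so modulo
  \<open>path_stab n\<close> only the image of \<open>R\<close> matters.\<close>

definition tail_stab :: "nat \<Rightarrow> ('c \<Rightarrow> 'c) set" where
  "tail_stab n = {h \<in> G. \<forall>k\<le>n. h ` (gpow (Suc k) ` R) = gpow (Suc k) ` R}"

lemma gpow_0_R: "gpow 0 ` R = R"
  using gpow_R[of 0] by simp

lemma all_le_Suc: "(\<forall>k\<le>Suc n. Q k) \<longleftrightarrow> (\<forall>k\<le>n. Q k) \<and> Q (Suc n)"
  by (auto simp: le_Suc_eq)

lemma compact_open_path_stab: "compact_open_subgroup C G (path_stab n)"
proof (induction n)
  case 0
  have "path_stab 0 = U" unfolding path_stab_def stabilizer_def using gpow_0_R by simp
  then show ?case using compact_open_U by simp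
next
  case (Suc n)
  have "path_stab (Suc n) = path_stab n \<inter> stabilizer G (gpow (Suc n) ` R)"
    unfolding path_stab_def stabilizer_def all_le_Suc by blast
  then show ?case
    using compact_open_Int[OF Suc] compact_open_stabilizer[OF spherical, of "gpow (Suc n) x"]
    unfolding gpow_R by simp
qed

lemma conj_by_path_stab: "conj_by \<Gamma> g (path_stab n) = tail_stab n"
proof (intro equalityI subsetI)
  fix h assume h: "h \<in> conj_by \<Gamma> g (path_stab n)"
  have sub: "path_stab n \<subseteq> G" by (auto simp: path_stab_def)
  have "h \<in> G" using aut.conj_by_carrier[of "path_stab n" g] h sub by auto
  moreover have "h ` (gpow (Suc k) ` R) = gpow (Suc k) ` R" if "k \<le> n" for k
    unfolding image_gpow_R[symmetric]
    by (rule conj_by_image(2)[OF h g sub gpow_R_C]) (use that in \<open>simp add: path_stab_def\<close>)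
  ultimately show "h \<in> tail_stab n" by (simp add: tail_stab_def)
next
  fix h assume h: "h \<in> tail_stab n"
  then have hG: "h \<in> G" by (simp add: tail_stab_def)
  have "((inv\<^bsub>\<Gamma>\<^esub> g \<otimes>\<^bsub>\<Gamma>\<^esub> h) \<otimes>\<^bsub>\<Gamma>\<^esub> g) ` (gpow k ` R) = gpow k ` R" if k: "k \<le> n" for k
  proof -
    have "((inv\<^bsub>\<Gamma>\<^esub> g \<otimes>\<^bsub>\<Gamma>\<^esub> h) \<otimes>\<^bsub>\<Gamma>\<^esub> g) ` (gpow k ` R) = (inv\<^bsub>\<Gamma>\<^esub> g) ` (h ` (gpow (Suc k) ` R))"
      using gpow_R_C[of k] gpow_R_C[of "Suc k"] image_gpow_R[of k] by (simp only: image_mult_\<Gamma>)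
    also have "\<dots> = (inv\<^bsub>\<Gamma>\<^esub> g) ` (gpow (Suc k) ` R)" using h k by (simp only: tail_stab_def mem_Collect_eq)
    also have "\<dots> = gpow k ` R" using image_inv_\<Gamma>[OF g gpow_R_C gpow_R_C] image_gpow_R by blast
    finally show ?thesis .
  qed
  then show "h \<in> conj_by \<Gamma> g (path_stab n)"
    using hG by (intro conj_byI) (simp_all add: path_stab_def mult_\<Gamma>_closed)
qed

text \<open>The conjugation index of \<open>path_stab n\<close> is the size of the \<open>tail_stab n\<close>-orbit of \<open>R\<close>, which lies in
  the \<open>tail_stab 0\<close>-orbit computing the index of \<open>U\<close>; minimality makes the two orbits equal.\<close>
lemma tail_transitive:
  assumes tidy: "tidy C G g U" and h: "h \<in> tail_stab 0"
  obtains h' where "h' \<in> tail_stab n" "h' ` R = h ` R"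
proof -
  let ?orb = "\<lambda>n. (\<lambda>h. h ` R) ` tail_stab n"
  have mono: "?orb n \<subseteq> ?orb 0" by (auto simp: tail_stab_def)
  have U0: "path_stab 0 = U" unfolding path_stab_def stabilizer_def using gpow_0_R by simp
  obtain F where F: "finite F" "card F \<le> conj_index C g U"
      "\<forall>h\<in>tail_stab 0. \<exists>f\<in>F. \<exists>v\<in>U. h = f \<otimes>\<^bsub>\<Gamma>\<^esub> v"
    using left_covered_conj_index[OF compact_open_U g] conj_by_path_stab[of 0]
    unfolding left_covered_def U0 by auto
  have "?orb 0 \<subseteq> (\<lambda>f. f ` R) ` F"
  proof
    fix B assume "B \<in> ?orb 0"
    then obtain h where h: "h \<in> tail_stab 0" "B = h ` R" by blast
    obtain f v where fv: "f \<in> F" "v \<in> U" "h = f \<otimes>\<^bsub>\<Gamma>\<^esub> v" using bspec[OF F(3) h(1)] by blast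
    then have "B = f ` (v ` R)" using h(2) image_mult_\<Gamma>[OF R_C] by simp
    also have "v ` R = R" using fv(2) by (simp add: stabilizer_def)
    finally show "B \<in> (\<lambda>f. f ` R) ` F" using fv(1) by blast
  qed
  then have fin0: "finite (?orb 0)" and card0: "card (?orb 0) \<le> conj_index C g U"
    using F(1,2) surj_card_le[OF F(1)] finite_surj[OF F(1)] by (blast, fastforce)
  have finn: "finite (?orb n)" using fin0 mono finite_subset by blast
  have tG: "tail_stab n \<subseteq> G" by (auto simp: tail_stab_def)
  have "conj_index C g (path_stab n) \<le> card (?orb n)"
  proof (rule conj_index_le[OF _ compact_open_path_stab g])
    let ?r = "inv_into (tail_stab n) (\<lambda>h. h ` R)"
    let ?E = "?r ` ?orb n"
    have "\<exists>e\<in>?E. \<exists>v\<in>path_stab n. k = e \<otimes>\<^bsub>\<Gamma>\<^esub> v" if k: "k \<in> tail_stab n" for k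
    proof -
      define e where "e = ?r (k ` R)"
      have e: "e \<in> tail_stab n" "e ` R = k ` R" "e \<in> ?E"
        using k inv_into_into[of "k ` R" "\<lambda>h. h ` R" "tail_stab n"]
          f_inv_into_f[of "k ` R" "\<lambda>h. h ` R" "tail_stab n"] by (auto simp: e_def)
      have ek: "e \<in> G" "k \<in> G" using e k tG by auto
      have "(inv\<^bsub>\<Gamma>\<^esub> e \<otimes>\<^bsub>\<Gamma>\<^esub> k) ` (gpow i ` R) = gpow i ` R" if i: "i \<le> n" for i
      proof -
        \<comment> \<open>On \<open>R\<close> the two agree by the choice of \<open>e\<close>; the
          later residues are stabilised by both.\<close>
        have "e ` (gpow i ` R) = k ` (gpow i ` R)"
        proof (cases i)
          case 0
          then show ?thesis using e(2) gpow_0_R by (simp only:)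
        next
          case (Suc j)
          then show ?thesis using e(1) k i unfolding tail_stab_def by (simp del: aut.nat_pow_Suc)
        qed
        moreover have "k ` (gpow i ` R) \<subseteq> C" using gpow_R_C[of i] ek by auto
        ultimately show ?thesis
          using image_inv_\<Gamma>[OF ek(1), of "k ` (gpow i ` R)" "gpow i ` R"] gpow_R_C[of i]
          by (simp only: image_mult_\<Gamma>)
      qed
      then have "inv\<^bsub>\<Gamma>\<^esub> e \<otimes>\<^bsub>\<Gamma>\<^esub> k \<in> path_stab n"
        using ek by (simp add: path_stab_def mult_\<Gamma>_closed)
      moreover have "k = e \<otimes>\<^bsub>\<Gamma>\<^esub> (inv\<^bsub>\<Gamma>\<^esub> e \<otimes>\<^bsub>\<Gamma>\<^esub> k)"
        using ek by (intro G_eqI) (simp_all add: mult_\<Gamma>_closed)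
      ultimately show ?thesis using e(3) by blast
    qed
    moreover have "?E \<subseteq> G"
    proof -
      have "?E \<subseteq> tail_stab n" by (auto intro: inv_into_into)
      then show ?thesis using tG by blast
    qed
    ultimately show "left_covered \<Gamma> (conj_by \<Gamma> g (path_stab n)) (path_stab n) (card (?orb n))"
      unfolding left_covered_def conj_by_path_stab
      using finn card_image_le[OF finn, of ?r] by (intro exI[of _ ?E]) auto
  qed
  moreover have "conj_index C g U \<le> conj_index C g (path_stab n)"
    using tidy compact_open_path_stab unfolding tidy_def by blast
  ultimately have "card (?orb 0) \<le> card (?orb n)" using card0 by simp
  then have "?orb n = ?orb 0" using card_seteq[OF fin0 mono] by blast
  then have "h ` R \<in> ?orb n" using h by blast
  then show ?thesis using that by force
qed

section \<open>Chamber walks with steps in one double coset\<close>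

definition walk :: "nat \<Rightarrow> (nat \<Rightarrow> 'c) \<Rightarrow> bool" where
  "walk n f \<longleftrightarrow> (\<forall>i\<le>n. f i \<in> C) \<and> (\<forall>i<n. \<delta> (f i) (f (Suc i)) \<in> double_coset J w)"

lemma walk_shift: "walk (Suc n) f \<Longrightarrow> walk n (\<lambda>i. f (Suc i))"
  by (simp add: walk_def)

lemma walk_Cons: "\<lbrakk>walk n f; p \<in> C; \<delta> p (f 0) \<in> double_coset J w\<rbrakk> \<Longrightarrow> walk (Suc n) (case_nat p f)"
  by (auto simp: walk_def le_Suc_eq less_Suc_eq_0_disj split: nat.split)

text \<open>Induction handles the shifted walk; composing with \<open>g^-1\<close> aligns its
  residues with those from \<open>g R\<close> onward, so that only \<open>R\<close> may be
  misplaced. Weyl transitivity corrects \<open>R\<close> by an element fixing \<open>g R\<close>,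
  and \<open>tail_transitive\<close> replaces this by one that fixes the remaining residues
  too.\<close>

lemma walk_residues:
  assumes tidy: "tidy C G g U" and "walk n f"
  shows "\<exists>h\<in>G. \<forall>i\<le>n. h ` (gpow i ` R) = residue W C \<delta> J (f i)"
  using assms(2)
proof (induction n arbitrary: f)
  case 0
  then have "f 0 \<in> C" by (simp add: walk_def)
  then obtain h where "h \<in> G" "h x = f 0" using transitive x by blast
  then have "h ` (gpow 0 ` R) = residue W C \<delta> J (f 0)"
    using gpow_0_R image_residue[of h x J] by (simp only: x)
  then show ?case using \<open>h \<in> G\<close> by auto
next
  case (Suc n)
  obtain h where h: "h \<in> G" "\<And>i. i \<le> n \<Longrightarrow> h ` (gpow i ` R) = residue W C \<delta> J (f (Suc i))"
    using Suc.IH[OF walk_shift[OF Suc.prems]] by blast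
  define k where "k = h \<otimes>\<^bsub>\<Gamma>\<^esub> inv\<^bsub>\<Gamma>\<^esub> g"
  have k: "k \<in> G" using h by (simp add: k_def mult_\<Gamma>_closed)
  have k_im: "k ` (gpow (Suc i) ` R) = residue W C \<delta> J (f (Suc i))" if "i \<le> n" for i
  proof -
    have "(inv\<^bsub>\<Gamma>\<^esub> g) ` (gpow (Suc i) ` R) = gpow i ` R"
      using image_inv_\<Gamma>[OF g gpow_R_C gpow_R_C] image_gpow_R by blast
    then show ?thesis
      unfolding k_def using gpow_R_C[of "Suc i"] h(2)[OF that] by (simp only: image_mult_\<Gamma>)
  qed
  have f: "f 0 \<in> C" "f (Suc 0) \<in> C" "\<delta> (f 0) (f (Suc 0)) \<in> double_coset J w"
    using Suc.prems by (auto simp: walk_def)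
  have inv_k: "inv\<^bsub>\<Gamma>\<^esub> k \<in> G" using k by simp
  \<comment> \<open>Pulled back by \<open>k\<close>, the first step of the walk becomes a step into
    \<open>g R\<close> and can be compared with the pair \<open>R\<close>,
    \<open>g R\<close>.\<close>
  define b where "b = (inv\<^bsub>\<Gamma>\<^esub> k) (f 0)"
  define c where "c = (inv\<^bsub>\<Gamma>\<^esub> k) (f (Suc 0))"
  have bc: "b \<in> C" "c \<in> C" "k b = f 0" "k c = f (Suc 0)"
    using inv_k f(1,2) k by (simp_all add: b_def c_def)
  have dbc: "\<delta> b c \<in> double_coset J (\<delta> x (g x))"
    unfolding b_def c_def dc_w using G_dist[OF inv_k f(1,2)] f(3) by simp
  have "\<delta> b c \<in> {\<delta> p q | p q. p \<in> R \<and> q \<in> g ` R}"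
    using dbc residue_dist_set[OF J x, of "g x"] by (simp add: image_residue)
  then obtain p q where pq: "p \<in> R" "q \<in> g ` R" "\<delta> b c = \<delta> p q" by blast
  have pqC: "p \<in> C" "q \<in> C" using pq R_C by auto
  obtain m where m: "m \<in> G" "m p = b" "m q = c"
    by (rule transitive_on_pairs[of p q b c]) (use pq(3) pqC bc in auto)
  have gR: "gpow (Suc 0) ` R = g ` R" using image_gpow_R[of 0] gpow_0_R by (simp only:)
  have "k ` (g ` R) = residue W C \<delta> J (k c)" using k_im[of 0] gR bc(4) by (simp only: le0)
  then have kgR: "k ` (g ` R) = k ` residue W C \<delta> J c" using image_residue[OF k bc(2)] by simp
  have gRC: "g ` R \<subseteq> C" using R_C by auto
  have gRc: "g ` R = residue W C \<delta> J c"
    using kgR by (rule iffD1[OF inj_on_image_eq_iff[OF G_inj[OF k] gRC residue_subset]])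
  have qgx: "residue W C \<delta> J q = g ` R"
    using residue_eq[OF J, of "g x" q] pq(2) by (simp add: image_residue)
  have "m ` (g ` R) = g ` R"
    using image_residue[OF m(1) pqC(2), of J] m(3) gRc qgx by simp
  then have "m \<in> tail_stab 0"
    unfolding tail_stab_def using m(1) gR by (simp del: aut.nat_pow_Suc)
  then obtain m' where m': "m' \<in> tail_stab n" "m' ` R = m ` R"
    using tail_transitive[OF tidy] by blast
  have m'G: "m' \<in> G" using m' by (simp add: tail_stab_def)
  have "m ` R = residue W C \<delta> J b"
    using image_residue[OF m(1) pqC(1), of J] residue_eq[OF J x pq(1)] m(2) by simp
  then have km: "k ` (m' ` R) = residue W C \<delta> J (f 0)"
    using m'(2) image_residue[OF k bc(1)] bc(3) by simp
  have "(k \<otimes>\<^bsub>\<Gamma>\<^esub> m') ` (gpow i ` R) = residue W C \<delta> J (f i)" if i: "i \<le> Suc n" for i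
  proof (cases i)
    case 0
    then show ?thesis using km gpow_0_R by (simp only: image_mult_\<Gamma> R_C)
  next
    case (Suc j)
    then have "m' ` (gpow i ` R) = gpow i ` R"
      using m'(1) i unfolding tail_stab_def by (simp del: aut.nat_pow_Suc)
    then show ?thesis
      using k_im[of j] i Suc gpow_R_C[of i] image_mult_\<Gamma>[OF gpow_R_C[of i], of k m']
      by (simp del: aut.nat_pow_Suc)
  qed
  then show ?case using mult_\<Gamma>_closed[OF k m'G] by blast
qed

lemma walk_dist:
  assumes tidy: "tidy C G g U" and f: "walk n f"
  shows "\<delta> (f 0) (f n) \<in> double_coset J (\<delta> x (gpow n x))"
proof -
  have fC: "f 0 \<in> C" "f n \<in> C" using f by (auto simp: walk_def)
  obtain h where h: "h \<in> G" "\<And>i. i \<le> n \<Longrightarrow> h ` (gpow i ` R) = residue W C \<delta> J (f i)"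
    using walk_residues[OF assms] by blast
  have "f 0 \<in> h ` R" "f n \<in> h ` (gpow n ` R)"
    using h(2)[of 0] h(2)[of n] residue_self[OF J fC(1)] residue_self[OF J fC(2)] gpow_0_R
    by (simp_all only: le0 order_refl)
  then obtain p q where pq: "p \<in> R" "q \<in> gpow n ` R" "f 0 = h p" "f n = h q" by blast
  moreover from this have "p \<in> C" "q \<in> C" using R_C gpow_R_C by blast+
  ultimately have "\<delta> (f 0) (f n) = \<delta> p q" using h(1) by simp
  then show ?thesis
    using residue_dist_set[OF J x, of "gpow n x"] pq(1,2) unfolding gpow_R by auto
qed

lemma walk_dist_eq:
  assumes "tidy C G g U" "walk n f" "walk n f'"
  shows "\<delta> (f' 0) (f' n) \<in> double_coset J (\<delta> (f 0) (f n))"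
proof -
  have "double_coset J (\<delta> (f 0) (f n)) = double_coset J (\<delta> x (gpow n x))"
    by (rule double_coset_eq[OF J _ walk_dist[OF assms(1,2)]]) simp
  then show ?thesis using walk_dist[OF assms(1,3)] by simp
qed

lemma w_in_dc: "w \<in> double_coset J w"
  using double_coset_self[OF J] by simp

text \<open>Built at the front by \<open>left_exist_mult\<close>, so the total is \<open>w^n\<close>
  even before the length of \<open>w^n\<close> is known.\<close>

lemma exists_walk:
  assumes "y \<in> C"
  shows "\<exists>f. walk n f \<and> f n = y \<and> \<delta> (f 0) y = w [^] n"
proof (induction n)
  case 0
  show ?case using assms by (intro exI[of _ "\<lambda>_. y"]) (simp add: walk_def)
next
  case (Suc n)
  then obtain f where f: "walk n f" "f n = y" "\<delta> (f 0) y = w [^] n" by blast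
  have "f 0 \<in> C" using f(1) by (simp add: walk_def)
  then obtain p where p: "p \<in> C" "\<delta> p (f 0) = w" "\<delta> p y = w \<otimes> w [^] n"
    using left_exist_mult[of w "f 0" y] assms f(3) by auto
  have "\<delta> p y = w [^] Suc n" using p(3) nat_pow_Suc2[OF w_carrier, of n] by simp
  then show ?case using walk_Cons[OF f(1) p(1)] p(2) w_in_dc f(2)
    by (intro exI[of _ "case_nat p f"]) simp
qed

text \<open>Prepend a step of type \<open>w u\<close>, which is as admissible as \<open>w\<close>.
  The total \<open>w u w^n\<close> must share its double coset with the total \<open>w^(n+1)\<close>
  of another walk; this is the hypothesis of the group-theoretic criterion.\<close>

lemma tidy_imp_normalizes:
  assumes tidy: "tidy C G g U" and "a \<in> A"
  shows "inv w \<otimes> a \<otimes> w \<in> A"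
proof (rule normalizes_if_powers_single_double_coset[OF A_subgroup finite_A w_carrier _ assms(2)])
  fix n :: nat and u assume u: "u \<in> A"
  obtain f where f: "walk n f" "f n = x" "\<delta> (f 0) x = w [^] n" using exists_walk x by blast
  have f0: "f 0 \<in> C" using f(1) by (simp add: walk_def)
  obtain p where p: "p \<in> C" "\<delta> p (f 0) = w \<otimes> u" "\<delta> p x = w \<otimes> u \<otimes> w [^] n"
    using left_exist_mult[of "w \<otimes> u" "f 0" x] f0 f(3) u by auto
  have "w \<otimes> u \<in> double_coset J w" by (rule dcI[of \<one> u]) (use u in simp_all)
  then have walk: "walk (Suc n) (case_nat p f)" using walk_Cons[OF f(1) p(1)] p(2) by simp
  obtain f' where f': "walk (Suc n) f'" "f' (Suc n) = x" "\<delta> (f' 0) x = w [^] Suc n"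
    using exists_walk x by blast
  have "\<delta> p x \<in> double_coset J (w [^] Suc n)"
    using walk_dist_eq[OF tidy f'(1) walk] f(2) f'(2,3) by (simp del: nat_pow_Suc)
  then show "\<exists>a\<in>A. \<exists>b\<in>A. w \<otimes> u \<otimes> w [^] n = a \<otimes> w [^] Suc n \<otimes> b"
    unfolding p(3) double_coset_def by blast
qed

lemma inj_on_conj: "X \<subseteq> carrier W \<Longrightarrow> inj_on (\<lambda>a. inv w \<otimes> a \<otimes> w) X"
  by (auto simp: inj_on_def subset_eq)

lemma conj_back: "a \<in> carrier W \<Longrightarrow> w \<otimes> (inv w \<otimes> a \<otimes> w) \<otimes> inv w = a"
proof -
  assume a: "a \<in> carrier W"
  have "w \<otimes> (inv w \<otimes> (a \<otimes> (w \<otimes> inv w))) = a" using a by (simp flip: m_assoc)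
  then show ?thesis using a by (simp add: m_assoc)
qed

text \<open>An injective map of a finite set into itself is onto, so the inclusion under conjugation
  by \<open>inv w\<close> can be inverted.\<close>

lemma conj_image:
  assumes "X \<subseteq> carrier W" "finite X" "\<And>a. a \<in> X \<Longrightarrow> inv w \<otimes> a \<otimes> w \<in> X"
  shows "(\<lambda>a. w \<otimes> a \<otimes> inv w) ` X = X"
proof -
  have X: "(\<lambda>a. inv w \<otimes> a \<otimes> w) ` X = X"
    using endo_inj_surj[OF assms(2) _ inj_on_conj[OF assms(1)]] assms(3) by blast
  have "(\<lambda>a. w \<otimes> a \<otimes> inv w) ` ((\<lambda>a. inv w \<otimes> a \<otimes> w) ` X) = X"
    using conj_back assms(1) by (simp add: image_image subset_eq)
  then show ?thesis by (simp only: X)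
qed

lemma tidy_imp_straight:
  assumes tidy: "tidy C G g U"
  shows "straight W S J w"
proof -
  note norm = tidy_imp_normalizes[OF tidy]
  have AA: "(\<lambda>a. w \<otimes> a \<otimes> inv w) ` A = A"
    by (rule conj_image[OF _ finite_A norm]) auto
  have norm': "w \<otimes> a \<otimes> inv w \<in> A" if "a \<in> A" for a using AA that by blast
  have norm_pow: "w [^] n \<otimes> a \<otimes> inv (w [^] n) \<in> A" if a: "a \<in> A" for a and n :: nat
  proof (induction n)
    case (Suc n)
    have "w [^] Suc n \<otimes> a \<otimes> inv (w [^] Suc n) = w \<otimes> (w [^] n \<otimes> a \<otimes> inv (w [^] n)) \<otimes> inv w"
      unfolding nat_pow_Suc2[OF w_carrier] using a by (simp add: m_assoc inv_mult_group)
    then show ?case using norm'[OF Suc] by simp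
  qed (use a in simp)
  \<comment> \<open>The conjugate \<open>t\<close> lies in \<open>A\<close> but must be shown to be
    a generator. The product \<open>w t = j w\<close> has length \<open>len w + 1\<close>, since
    minimality of \<open>w\<close> excludes a drop. By \<open>double_coset_reduced\<close> with
    empty left word, \<open>t\<close> is then a word of length one in \<open>J\<close>.\<close>
  have "inv w \<otimes> j \<otimes> w \<in> J" if j: "j \<in> J" for j
  proof -
    have jS: "j \<in> S" and jA: "j \<in> A" using j J by (auto simp: parabolic_def generate.incl)
    define t where "t = inv w \<otimes> j \<otimes> w"
    have t: "t \<in> A" unfolding t_def by (rule norm[OF jA])
    have "w \<otimes> (inv w \<otimes> (j \<otimes> w)) = j \<otimes> w" using jS by (simp flip: m_assoc)
    then have wt: "w \<otimes> t = j \<otimes> w" using jS unfolding t_def by (simp add: m_assoc)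
    have "j \<otimes> w \<in> double_coset J w" by (rule dcI[of j \<one>]) (use jA jS in simp_all)
    then have len: "len (w \<otimes> t) = len w + 1"
      using w_min[of "j \<otimes> w"] len_left_cases[OF jS w_carrier] wt by auto
    obtain ts where ts: "set ts \<subseteq> J" "wprod W ts = t" using t parabolic_word[OF J] by blast
    obtain as bs where ab: "subseq as []" "subseq bs ts" "w \<otimes> t = wprod W as \<otimes> w \<otimes> wprod W bs"
        "len (w \<otimes> t) = length as + len w + length bs"
      by (rule double_coset_reduced[OF J w_carrier w_min, of "[]" ts "w \<otimes> t"]) (use ts t in auto)
    have "as = []" using ab(1) by (cases as) auto
    have bs: "set bs \<subseteq> J" using ab(2) ts(1) subseq_set by blast
    then have "set bs \<subseteq> S" using J by blast
    then have "w \<otimes> t = w \<otimes> wprod W bs" using ab(3) \<open>as = []\<close> by simp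
    then have tbs: "t = wprod W bs" using t \<open>set bs \<subseteq> S\<close> by simp
    have "length bs = 1" using ab(4) \<open>as = []\<close> len by simp
    then obtain s where "bs = [s]" by (auto simp: length_Suc_conv)
    then have "t = s" "s \<in> J" using tbs bs J by auto
    then show ?thesis by (simp add: t_def)
  qed
  then have JJ: "(\<lambda>i. w \<otimes> i \<otimes> inv w) ` J = J"
    using J S_carrier coxeter finite_subset[OF J]
    by (intro conj_image) (auto simp: coxeter_system_def)
  \<comment> \<open>If lengths failed to add, \<open>deletion_realised\<close> would give a walk
    with total \<open>u w^n\<close> and \<open>u\<close> shorter than \<open>w\<close>. Tidiness
    puts this into \<open>A w^(n+1) A\<close>; since \<open>w^n\<close> normalises \<open>A\<close>,
    the right factor moves across \<open>w^n\<close>, which cancels and leaves \<open>u\<close> in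
    \<open>A w A\<close>, against minimality of \<open>w\<close>.\<close>
  have add: "len (w \<otimes> w [^] n) = len w + len (w [^] n)" for n :: nat
  proof (rule ccontr)
    assume "len (w \<otimes> w [^] n) \<noteq> len w + len (w [^] n)"
    then have less: "len (w \<otimes> w [^] n) < len w + len (w [^] n)"
      using len_mult_le[of w "w [^] n"] by simp
    obtain f where f: "walk n f" "f n = x" "\<delta> (f 0) x = w [^] n" using exists_walk x by blast
    have f0: "f 0 \<in> C" using f(1) by (simp add: walk_def)
    obtain z u where z: "z \<in> C" "u \<in> carrier W" "\<delta> z (f 0) = w" "\<delta> z x = u \<otimes> w [^] n" "len u < len w"
      using deletion_realised[of w "f 0" x] f0 f(3) less by auto
    have walk: "walk (Suc n) (case_nat z f)" using walk_Cons[OF f(1) z(1)] z(3) w_in_dc by simp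
    obtain f' where f': "walk (Suc n) f'" "f' (Suc n) = x" "\<delta> (f' 0) x = w [^] Suc n"
      using exists_walk x by blast
    have "\<delta> z x \<in> double_coset J (w [^] Suc n)"
      using walk_dist_eq[OF tidy f'(1) walk] f(2) f'(2,3) by (simp del: nat_pow_Suc)
    then obtain a b where ab: "a \<in> A" "b \<in> A" "u \<otimes> w [^] n = a \<otimes> (w \<otimes> w [^] n) \<otimes> b"
      unfolding z(4) double_coset_def nat_pow_Suc2[OF w_carrier] by blast
    define c where "c = w [^] n \<otimes> b \<otimes> inv (w [^] n)"
    have c: "c \<in> A" unfolding c_def by (rule norm_pow[OF ab(2)])
    have "c \<otimes> w [^] n = w [^] n \<otimes> b" unfolding c_def using ab by (simp add: m_assoc)
    then have "u \<otimes> w [^] n = (a \<otimes> w \<otimes> c) \<otimes> w [^] n" using ab c by (simp add: m_assoc)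
    then have "u = a \<otimes> w \<otimes> c" using z(2) ab c by simp
    then have "len w \<le> len u" using w_min dcI[OF ab(1) c] by blast
    then show False using z(5) by simp
  qed
  have len_pow: "len (w [^] n) = n * len w" for n :: nat
  proof (induction n)
    case (Suc n)
    then show ?case using add[of n] unfolding nat_pow_Suc2[OF w_carrier] by simp
  qed simp
  show ?thesis unfolding straight_def
    using JJ len_pow w_min dcI by auto
qed

end

theorem theorem5p5:
  fixes W :: "('w, 'b) monoid_scheme" and S :: "'w set"
    and C :: "'c set" and \<delta> :: "'c \<Rightarrow> 'c \<Rightarrow> 'w"
    and G :: "('c \<Rightarrow> 'c) set" and g :: "'c \<Rightarrow> 'c"
    and J :: "'w set" and x :: 'c
  assumes "building W S C \<delta>"
    and "thick S C \<delta>"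
    and "locally_finite S C \<delta>"
    and "perm_subgroup C G (tp_aut C \<delta>)"
    and "closedin (subtopology (aut_topology C) (tp_aut C \<delta>)) G"
    and "weyl_transitive C \<delta> G"
    and "g \<in> G"
    and "spherical W S J"
    and "x \<in> C"
  shows "tidy C G g (stabilizer G (residue W C \<delta> J x)) \<longleftrightarrow>
         straight W S J (simplex_dist W S \<delta> (residue W C \<delta> J x) (g ` residue W C \<delta> J x))"
proof -
  have "coxeter_system W S" using assms(1) unfolding building_def by (elim conjE)
  then interpret moved_residue W S C \<delta> G J x g
    by unfold_locales (use assms in auto)
  show ?thesis using tidy_imp_straight straight_imp_tidy by blast
qed

end
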